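(* Let $d\ge 1$. Let $\mu$ be a probability measure on $(\mathscr S(d),\mathcal B(d)')$ that is stationary and ergodic with respect to the shifts $\{\tau_x\}_{x\in\mathbb Z^d}$, and let $\mathscr E:S(d)\to S(d)$ be a measurable balanced environment function. Assume: (1) $\int_{\mathscr S(d)} c(\mathscr E,0)(\omega)^{-p}\,d\mu(\omega)<\infty$ for some $p>d$; (2) the environment is elliptic: $\mu[\mathscr E_k(\omega)(x)>0 \ \ \forall x\in\mathbb Z^d,\ \forall k]=1$. Then there exists a probability measure $\lambda$ on $(\mathscr S(d),\mathcal B(d)')$, mutually absolutely continuous with $\mu$ (i.e. having the same null sets), such that the environment process $\{\tau_{X_{\mathscr E(\omega)}(k)}\omega\}_{k\ge0}$ with initial law $\omega\sim\lambda$ is stationary and ergodic.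
   Context: $V_d=\{\pm e_i:i=1,\dots,d\}\cup\{0\}$, with $e_i$ the standard unit vectors of $\mathbb Z^d$. $S(d)=\{(p_0,p_1,\dots,p_{2d}):p_i\ge0,\ \sum_{i=0}^{2d}p_i=1\}$; $\mathscr S(d)$ is the set of all functions $\omega:\mathbb Z^d\to S(d)$ (product topology), and $\mathcal B(d)'$ is its Borel $\sigma$-algebra. Shifts: $(\tau_x\omega)(y)=\omega(x+y)$. $\mu$ is stationary if it is invariant under all $\tau_x$, and ergodic if every event invariant under all shifts has $\mu$-probability $0$ or $1$ (equivalently $\mu[\bigcap_{x}\tau_xB]\in\{0,1\}$ for all $B\in\mathcal B(d)'$). An environment function is a measurable map $\mathscr E:S(d)\to S(d)$, extended to $\mathscr S(d)$ by $\mathscr E(\omega)(x)=\mathscr E(\omega(x))$; its coordinates are written $\mathscr E_k(\omega)(x)$, $k=0,\dots,2d$, and one writes $\mathscr E(\omega)(x,e_i)=\mathscr E_i(\omega)(x)$, $\mathscr E(\omega)(x,-e_i)=\mathscr E_{i+d}(\omega)(x)$, $\mathscr E(\omega)(x,0)=\mathscr E_0(\omega)(x)$. It is balanced if $\mathscr E_i(\omega)(x)=\mathscr E_{i+d}(\omega)(x)$ for all $x$ and $i=1,\dots,d$. Put $c(\mathscr E,x)(\omega)=\big[\prod_{v\in V_d\setminus\{0\}}\mathscr E(\omega)(x,v)\big]^{1/(2d)}$. For fixed $\omega$, $\{X_{\mathscr E(\omega)}(k)\}_{k\ge0}$ is the Markov chain on $\mathbb Z^d$ started at $0$ with transition probabilities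 $x\mapsto x+v$ equal to $\mathscr E(\omega)(x,v)$, $v\in V_d$. The environment process $\{\tau_{X_{\mathscr E(\omega)}(k)}\omega\}_{k\ge0}$ is the Markov chain on $\mathscr S(d)$ with kernel $K_d^{\mathscr E}(\omega,B)=\sum_{v\in V_d}\mathscr E(\omega)(0,v)\,\delta_{\tau_v\omega}(B)$. *)

theory Defs
  imports "HOL-Probability.Probability"
begin

text \<open>
  The lattice \<open>\<int>\<^sup>d\<close> is \<open>int ^ 'd\<close> with \<open>d = CARD('d)\<close>, so \<open>d \<ge> 1\<close> holds automatically.
  The coordinate index \<open>k \<in> {0, \<dots>, 2 d}\<close> is a value of the type \<open>'d dir\<close>: \<open>k = 0\<close> is \<open>Stay\<close>,
  \<open>k = i\<close> is \<open>Fwd i\<close> and \<open>k = i + d\<close> is \<open>Bwd i\<close>. The function \<open>step\<close> identifies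
  \<open>'d dir\<close> with the set of allowed steps \<open>V\<^sub>d\<close>.
\<close>

datatype 'd dir = Stay | Fwd 'd | Bwd 'd

lemma UNIV_dir: "(UNIV :: 'd dir set) = insert Stay (range Fwd \<union> range Bwd)"
  by (simp add: set_eq_iff image_iff) (metis dir.exhaust)

instance dir :: (finite) finite
  by standard (simp add: UNIV_dir)

fun step :: "'d::finite dir \<Rightarrow> int ^ 'd" where
  "step Stay = 0"
| "step (Fwd i) = axis i 1"
| "step (Bwd i) = - axis i 1"

lemma bij_betw_step:
  "bij_betw step (UNIV :: 'd::finite dir set)
     ({axis i 1 |i. True} \<union> {- axis i 1 |i. True} \<union> {0})"
proof -
  have neq: "axis i (1::int) \<noteq> - axis j 1" for i j :: 'd
  proof
    assume "axis i (1::int) = - axis j 1"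
    then have "axis i (1::int) $ i = (- axis j 1) $ i" by (rule arg_cong)
    then show False by (simp add: axis_def split: if_splits)
  qed
  have "u = v" if "step u = step v" for u v :: "'d dir"
    using that neq neq[symmetric]
    by (cases u; cases v) (simp_all add: axis_eq_axis axis_eq_0_iff)
  then have "inj (step :: 'd dir \<Rightarrow> int ^ 'd)" by (rule injI)
  moreover have "range (step :: 'd dir \<Rightarrow> int ^ 'd) =
      {axis i 1 |i. True} \<union> {- axis i 1 |i. True} \<union> {0}"
    unfolding UNIV_dir by (simp add: image_Un image_image full_SetCompr_eq)
  ultimately show ?thesis by (simp add: bij_betw_def)
qed


type_synonym 'd environment = "(int, 'd) vec \<Rightarrow> 'd dir \<Rightarrow> real"

definition prob_simplex :: "('d::finite dir \<Rightarrow> real) set" where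
  "prob_simplex = {p. (\<forall>k. 0 \<le> p k) \<and> (\<Sum>k\<in>UNIV. p k) = 1}"

definition simplex_borel :: "('d::finite dir \<Rightarrow> real) measure" where
  "simplex_borel = restrict_space borel prob_simplex"

text \<open>
  In the next definition \<open>borel\<close> belongs to the product topology on \<open>'d environment\<close>;
  its trace on \<open>{\<omega>. \<forall>x. \<omega> x \<in> prob_simplex}\<close> is the Borel algebra of the subspace topology.
\<close>

definition env_borel :: "'d::finite environment measure" where
  "env_borel = restrict_space borel {\<omega>. \<forall>x. \<omega> x \<in> prob_simplex}"

definition shift :: "int ^ 'd \<Rightarrow> 'd::finite environment \<Rightarrow> 'd environment" where
  "shift x \<omega> = (\<lambda>y. \<omega> (x + y))"


text \<open>
  Stationarity and ergodicity are stated for a family \<open>\<F>\<close> of transformations. They apply both to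
  the lattice shifts on environments and to the time shift on the path space of a process.
\<close>

definition stationary_under :: "'a measure \<Rightarrow> ('a \<Rightarrow> 'a) set \<Rightarrow> bool" where
  "stationary_under M \<F> \<longleftrightarrow> (\<forall>T\<in>\<F>. T \<in> measurable M M \<and> distr M M T = M)"

definition ergodic_under :: "'a measure \<Rightarrow> ('a \<Rightarrow> 'a) set \<Rightarrow> bool" where
  "ergodic_under M \<F> \<longleftrightarrow>
     (\<forall>A\<in>sets M. (\<forall>T\<in>\<F>. T -` A \<inter> space M = A) \<longrightarrow> measure M A \<in> {0, 1})"

definition time_shift :: "(nat \<Rightarrow> 'a) \<Rightarrow> nat \<Rightarrow> 'a" where
  "time_shift X = (\<lambda>n. X (Suc n))"


text \<open>
  An environment function is a map \<open>\<E>\<close> on the simplex, and \<open>\<E>(\<omega>)(x, step k)\<close> is \<open>\<E> (\<omega> x) k\<close>.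
\<close>

definition balanced :: "(('d::finite dir \<Rightarrow> real) \<Rightarrow> ('d dir \<Rightarrow> real)) \<Rightarrow> bool" where
  "balanced \<E> \<longleftrightarrow> (\<forall>\<omega>\<in>space env_borel. \<forall>x i. \<E> (\<omega> x) (Fwd i) = \<E> (\<omega> x) (Bwd i))"

definition step_gmean ::
    "(('d::finite dir \<Rightarrow> real) \<Rightarrow> ('d dir \<Rightarrow> real)) \<Rightarrow> int ^ 'd \<Rightarrow> 'd environment \<Rightarrow> real" where
  "step_gmean \<E> x \<omega> = (\<Prod>k\<in>UNIV - {Stay}. \<E> (\<omega> x) k) powr (1 / (2 * real CARD('d)))"


text \<open>
  The law on path space of the (time-homogeneous) Markov chain with state space \<open>M\<close>,
  initial law \<open>\<nu>\<close> and transition kernel \<open>K\<close>, built by the Ionescu-Tulcea construction.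
\<close>

definition markov_chain_law :: "'a measure \<Rightarrow> 'a measure \<Rightarrow> ('a \<Rightarrow> 'a measure) \<Rightarrow> (nat \<Rightarrow> 'a) measure"
  where
  "markov_chain_law M \<nu> K =
     projective_family.lim UNIV
       (Ionescu_Tulcea.CI (\<lambda>n X. if n = 0 then \<nu> else K (X (n - 1))) (\<lambda>_. M)) (\<lambda>_. M)"

definition walk_kernel ::
    "(('d::finite dir \<Rightarrow> real) \<Rightarrow> ('d dir \<Rightarrow> real)) \<Rightarrow> 'd environment \<Rightarrow> int ^ 'd \<Rightarrow> (int ^ 'd) measure"
  where
  "walk_kernel \<E> \<omega> x =
     distr (point_measure UNIV (\<lambda>k. ennreal (\<E> (\<omega> x) k))) (count_space UNIV) (\<lambda>k. x + step k)"

definition walk_law ::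
    "(('d::finite dir \<Rightarrow> real) \<Rightarrow> ('d dir \<Rightarrow> real)) \<Rightarrow> 'd environment \<Rightarrow> (nat \<Rightarrow> int ^ 'd) measure"
  where
  "walk_law \<E> \<omega> =
     markov_chain_law (count_space UNIV) (return (count_space UNIV) 0) (walk_kernel \<E> \<omega>)"

text \<open>
  The law of the environment process \<open>k \<mapsto> shift (X k) \<omega>\<close>, where \<open>\<omega>\<close> has law \<open>\<nu>\<close> and, given
  \<open>\<omega>\<close>, \<open>X\<close> is the walk started at \<open>0\<close> in the environment \<open>\<E>(\<omega>)\<close>.
\<close>

definition env_process_law ::
    "(('d::finite dir \<Rightarrow> real) \<Rightarrow> ('d dir \<Rightarrow> real)) \<Rightarrow> 'd environment measure
      \<Rightarrow> (nat \<Rightarrow> 'd environment) measure" where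
  "env_process_law \<E> \<nu> =
     \<nu> \<bind> (\<lambda>\<omega>. distr (walk_law \<E> \<omega>) (\<Pi>\<^sub>M n\<in>UNIV. env_borel) (\<lambda>X n. shift (X n) \<omega>))"

end

theory Submission
  imports Defs
begin

text \<open>
  Let \<open>P\<close> be the transition operator of the environment process.  For bounded \<open>g\<close>, integrate over
  \<open>\<mu>\<close> the expectation of \<open>\<Sum>k < min (L\<^sup>2) \<tau>. g (shift (X k) \<omega>)\<close>, where \<open>\<tau>\<close> is the exit time of
  the walk from the cube of side \<open>2 L\<close>, and divide by \<open>L\<^sup>2\<close>.  The resulting functionals are at least \<open>1/2\<close>
  at \<open>g = 1\<close> and differ by \<open>O(1/L\<^sup>2)\<close> at \<open>P g\<close> and \<open>g\<close>.  The maximum principle for balanced walks and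
  the stationarity of \<open>\<mu>\<close> bound them, for \<open>0 \<le> g \<le> 1\<close> and every \<open>\<delta> > 0\<close>, by
  \<open>\<delta> + C(\<delta>) \<integral> g W d\<mu>\<close>, where \<open>W\<close> is the inverse of the product of the forward probabilities at
  the origin; \<open>W\<close> is integrable by the moment assumption.  Every limit of these functionals
  along a filter is therefore continuous along bounded sequences tending to zero, so it is integration
  against an invariant finite measure that is absolutely continuous with respect to \<open>\<mu>\<close>.

  A null set of an invariant \<open>\<nu>\<close> has null translates, by ellipticity, so the union of its translates
  is \<open>\<mu>\<close>-null by ergodicity, which gives the equivalence of the two measures.  If \<open>A\<close> is a time-shift
  invariant event, then \<open>h(\<omega>) = P\<^sub>\<omega>(A)\<close> is harmonic; stationarity makes the integrated conditional
  variance of one step of \<open>h\<close> vanish, so \<open>h\<close> is constant on almost every orbit of the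
  lattice shifts.  Comparison on cylinders then shows that \<open>A\<close> is independent of itself under
  \<open>P\<^sub>\<omega>\<close>, and the set \<open>{h = 1}\<close> is trivial because \<open>\<mu>\<close> is ergodic.
\<close>

section \<open>The killed walk in a fixed environment\<close>

lemma sum_dir: "(\<Sum>k\<in>UNIV. F k) = F Stay + (\<Sum>i\<in>UNIV. F (Fwd i)) + (\<Sum>i\<in>UNIV. F (Bwd i))"
  for F :: "'d::finite dir \<Rightarrow> 'a::comm_monoid_add"
proof -
  have "(\<Sum>k\<in>UNIV. F k) = F Stay + (\<Sum>k\<in>range Fwd \<union> range Bwd. F k)"
    unfolding UNIV_dir by (subst sum.insert) auto
  also have "(\<Sum>k\<in>range Fwd \<union> range Bwd. F k) = (\<Sum>k\<in>range Fwd. F k) + (\<Sum>k\<in>range Bwd. F k)"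
    by (rule sum.union_disjoint) auto
  also have "(\<Sum>k\<in>range Fwd. F k) = (\<Sum>i\<in>UNIV. F (Fwd i))"
    by (subst sum.reindex) (auto simp: inj_def)
  also have "(\<Sum>k\<in>range Bwd. F k) = (\<Sum>i\<in>UNIV. F (Bwd i))"
    by (subst sum.reindex) (auto simp: inj_def)
  finally show ?thesis by (simp add: add.assoc)
qed

lemma prod_dir: "(\<Prod>k\<in>UNIV - {Stay}. F k) = (\<Prod>i\<in>UNIV. F (Fwd i)) * (\<Prod>i\<in>UNIV. F (Bwd i))"
  for F :: "'d::finite dir \<Rightarrow> 'a::comm_monoid_mult"
proof -
  have "UNIV - {Stay :: 'd dir} = range Fwd \<union> range Bwd"
    unfolding UNIV_dir by auto
  then have "(\<Prod>k\<in>UNIV - {Stay}. F k) = (\<Prod>k\<in>range Fwd. F k) * (\<Prod>k\<in>range Bwd. F k)"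
    by (simp only:) (rule prod.union_disjoint, auto)
  also have "(\<Prod>k\<in>range Fwd. F k) = (\<Prod>i\<in>UNIV. F (Fwd i))"
    by (subst prod.reindex) (auto simp: inj_def)
  also have "(\<Prod>k\<in>range Bwd. F k) = (\<Prod>i\<in>UNIV. F (Bwd i))"
    by (subst prod.reindex) (auto simp: inj_def)
  finally show ?thesis .
qed

definition walk_op ::
    "(int ^ 'd \<Rightarrow> 'd::finite dir \<Rightarrow> real) \<Rightarrow> (int ^ 'd \<Rightarrow> real) \<Rightarrow> int ^ 'd \<Rightarrow> real" where
  "walk_op q h x = (\<Sum>k\<in>UNIV. q x k * h (x + step k))"

text \<open>The strict inequality makes this an open cube: a neighbour \<open>y\<close> of one of
  its points satisfies \<open>\<bar>y $ i\<bar> \<le> int L\<close> for all \<open>i\<close>, even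
  when it leaves the cube.\<close>

definition lattice_cube :: "nat \<Rightarrow> (int ^ 'd::finite) set" where
  "lattice_cube L = {x. \<forall>i. \<bar>x $ i\<bar> < int L}"

text \<open>
  \<open>killed_green q L f n x\<close> is the expectation of \<open>\<Sum>k < min n \<tau>. f (X k)\<close> for the walk \<open>X\<close>
  started at \<open>x\<close>, where \<open>\<tau>\<close> is the exit time from the cube.
\<close>

primrec killed_green ::
    "(int ^ 'd \<Rightarrow> 'd::finite dir \<Rightarrow> real) \<Rightarrow> nat \<Rightarrow> (int ^ 'd \<Rightarrow> real) \<Rightarrow> nat \<Rightarrow> int ^ 'd \<Rightarrow> real" where
  "killed_green q L f 0 = (\<lambda>x. 0)"
| "killed_green q L f (Suc n) =
     (\<lambda>x. if x \<in> lattice_cube L then f x + walk_op q (killed_green q L f n) x else 0)"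

lemma walk_op_add: "walk_op q (\<lambda>x. g x + h x) x = walk_op q g x + walk_op q h x"
  by (simp add: walk_op_def algebra_simps sum.distrib)

lemma walk_op_cmult: "walk_op q (\<lambda>x. c * h x) x = c * walk_op q h x"
  by (simp add: walk_op_def algebra_simps sum_distrib_left)

lemma killed_green_add:
  "killed_green q L (\<lambda>x. g x + h x) n x = killed_green q L g n x + killed_green q L h n x"
proof (induction n arbitrary: x)
  case (Suc n)
  then have "killed_green q L (\<lambda>x. g x + h x) n = (\<lambda>x. killed_green q L g n x + killed_green q L h n x)"
    by blast
  then show ?case by (simp add: walk_op_add)
qed simp

lemma killed_green_cmult: "killed_green q L (\<lambda>x. c * h x) n x = c * killed_green q L h n x"
proof (induction n arbitrary: x)
  case (Suc n)
  then have "killed_green q L (\<lambda>x. c * h x) n = (\<lambda>x. c * killed_green q L h n x)"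
    by blast
  then show ?case by (simp add: walk_op_cmult algebra_simps)
qed simp

lemma lattice_cube_eq:
  "lattice_cube L = vec_lambda ` (PiE UNIV (\<lambda>_. {- int L<..<int L}))"
proof -
  have "x \<in> vec_lambda ` (PiE UNIV (\<lambda>_. {- int L<..<int L}))" if "x \<in> lattice_cube L" for x :: "int ^ 'd"
    using that by (intro image_eqI[of _ _ "\<lambda>i. x $ i"])
      (auto simp: lattice_cube_def PiE_iff abs_less_iff minus_less_iff)
  moreover have "vec_lambda f \<in> lattice_cube L" if "f \<in> PiE UNIV (\<lambda>_. {- int L<..<int L})" for f :: "'d::finite \<Rightarrow> int"
    using that by (auto simp: lattice_cube_def PiE_iff abs_less_iff minus_less_iff)
  ultimately show ?thesis by blast
qed

lemma finite_lattice_cube [simp]: "finite (lattice_cube L :: (int ^ 'd::finite) set)"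
  unfolding lattice_cube_eq by (intro finite_imageI finite_PiE) auto

text \<open>Each coordinate takes 2 L - 1 values when L > 0. The rounder bound (2 L)^d later cancels
  the power of L coming from the maximum principle.\<close>

lemma card_lattice_cube: "card (lattice_cube L :: (int ^ 'd::finite) set) \<le> (2 * L) ^ CARD('d)"
proof -
  have "card (lattice_cube L :: (int ^ 'd) set) \<le> card (PiE (UNIV :: 'd set) (\<lambda>_. {- int L<..<int L}))"
    unfolding lattice_cube_eq by (intro card_image_le finite_PiE) auto
  also have "\<dots> = card {- int L<..<int L} ^ CARD('d)"
    by (simp add: card_PiE)
  also have "\<dots> \<le> (2 * L) ^ CARD('d)"
    by (intro power_mono) auto
  finally show ?thesis .
qed

section \<open>Balanced walks: monotonicity, the maximum principle and exit times\<close>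

locale balanced_lattice_walk =
  fixes q :: "int ^ 'd \<Rightarrow> 'd::finite dir \<Rightarrow> real"
  assumes in_simplex: "q x \<in> prob_simplex"
    and balanced: "q x (Fwd i) = q x (Bwd i)"
begin

lemma nonneg: "0 \<le> q x k"
  using in_simplex[of x] by (simp add: prob_simplex_def)

lemma sum_eq_1: "(\<Sum>k\<in>UNIV. q x k) = 1"
  using in_simplex[of x] by (simp add: prob_simplex_def)

lemma walk_op_mono: "(\<And>y. g y \<le> h y) \<Longrightarrow> walk_op q g x \<le> walk_op q h x"
  unfolding walk_op_def by (intro sum_mono mult_left_mono nonneg) auto

lemma walk_op_const: "walk_op q (\<lambda>_. c) x = c"
  using sum_eq_1[of x] by (simp add: walk_op_def sum_distrib_right[symmetric])

text \<open>Balancedness removes the drift: once \<open>q x Stay\<close> is eliminated through the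
  total mass, the generator is a nonnegative combination of pure second differences.\<close>

lemma walk_op_diff:
  "walk_op q u x - u x = (\<Sum>i\<in>UNIV. q x (Fwd i) * (u (x + axis i 1) + u (x - axis i 1) - 2 * u x))"
proof -
  have "q x Stay = 1 - 2 * (\<Sum>i\<in>UNIV. q x (Fwd i))"
    using sum_eq_1[of x] by (simp add: sum_dir balanced)
  then have "walk_op q u x - u x = (\<Sum>i\<in>UNIV. q x (Fwd i) * u (x + axis i 1))
      + (\<Sum>i\<in>UNIV. q x (Fwd i) * u (x - axis i 1)) - 2 * (u x * (\<Sum>i\<in>UNIV. q x (Fwd i)))"
    by (simp only: walk_op_def sum_dir balanced[symmetric]) (simp add: algebra_simps)
  then show ?thesis
    by (simp add: algebra_simps sum.distrib sum_subtractf sum_distrib_left)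
qed

lemma killed_green_nonneg:
  assumes "\<And>x. 0 \<le> f x"
  shows "0 \<le> killed_green q L f n x"
proof (induction n arbitrary: x)
  case (Suc n)
  from walk_op_mono[of "\<lambda>_. 0" "killed_green q L f n" x] Suc assms[of x] show ?case
    by (auto simp: walk_op_const)
qed simp

lemma killed_green_Suc_mono:
  assumes "\<And>x. 0 \<le> f x"
  shows "killed_green q L f n x \<le> killed_green q L f (Suc n) x"
proof (induction n arbitrary: x)
  case 0
  show ?case using killed_green_nonneg[where f=f and n=1] assms by simp
next
  case (Suc n)
  show ?case
    using walk_op_mono[OF Suc.IH, where x=x] by (subst (1 2) killed_green.simps(2)) (simp del: killed_green.simps)
qed

text \<open>The recursion relates two horizons; monotonicity in \<open>n\<close> turns it into the
  inequality u - P u \<le> f for a single function u, the form in which the maximum principle is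
  applied.\<close>

lemma killed_green_le_step:
  assumes "\<And>x. 0 \<le> f x" "x \<in> lattice_cube L"
  shows "killed_green q L f n x \<le> f x + walk_op q (killed_green q L f n) x"
  using killed_green_Suc_mono[where f=f and L=L and n=n and x=x] assms by simp

lemma abs_killed_green_le:
  assumes "\<And>x. \<bar>f x\<bar> \<le> c"
  shows "\<bar>killed_green q L f n x\<bar> \<le> n * c"
proof (induction n arbitrary: x)
  case (Suc n)
  have c: "0 \<le> c" using assms[of 0] by linarith
  have "killed_green q L f n y \<le> n * c" "- (n * c) \<le> killed_green q L f n y" for y
    using Suc[of y] by linarith+
  then have "walk_op q (killed_green q L f n) x \<le> n * c" "- (n * c) \<le> walk_op q (killed_green q L f n) x"
    using walk_op_mono[of "killed_green q L f n" "\<lambda>_. n * c" x] walk_op_mono[of "\<lambda>_. - (n * c)" "killed_green q L f n" x]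
    by (simp_all add: walk_op_const)
  then have "\<bar>f x + walk_op q (killed_green q L f n) x\<bar> \<le> (1 + n) * c"
    using assms[of x] by (simp add: algebra_simps abs_le_iff)
  then show ?case using c by (simp add: algebra_simps)
qed simp

text \<open>
  With \<open>z = f + killed_green q L (P f - f) n\<close>, one more step replaces \<open>z\<close> by \<open>P z\<close> inside the cube
  and by \<open>f\<close> outside.
\<close>

lemma abs_killed_green_coboundary_le:
  assumes f: "\<And>x. 0 \<le> f x" "\<And>x. f x \<le> c"
  shows "\<bar>killed_green q L (\<lambda>x. walk_op q f x - f x) n x\<bar> \<le> c"
proof -
  let ?w = "killed_green q L (\<lambda>x. walk_op q f x - f x)"
  have "0 \<le> f x + ?w n x \<and> f x + ?w n x \<le> c" for n x
  proof (induction n arbitrary: x)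
    case 0
    then show ?case using f by simp
  next
    case (Suc n)
    have "0 \<le> walk_op q (\<lambda>x. f x + ?w n x) x" "walk_op q (\<lambda>x. f x + ?w n x) x \<le> c"
      using walk_op_mono[of "\<lambda>_. 0" "\<lambda>x. f x + ?w n x" x] walk_op_mono[of "\<lambda>x. f x + ?w n x" "\<lambda>_. c" x] Suc
      by (simp_all add: walk_op_const)
    then show ?case using f by (simp add: walk_op_add)
  qed
  \<comment> \<open>Both z and \<open>f\<close> take values in [0, c], so their difference is at
    most c in absolute value, however large \<open>n\<close> is.\<close>
  from this[of x n] f[of x] show ?thesis by auto
qed

text \<open>
  A discrete Aleksandrov--Bakelman--Pucci estimate: every slope in a cube of side
  \<open>2 u(0) / (d L)\<close> supports the graph of \<open>u\<close> from above at some lattice point \<open>x\<close>, and the slopes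
  supporting at \<open>x\<close> lie in a box whose sides are the second differences of \<open>u\<close>.
\<close>

lemma discrete_maximum_principle:
  assumes L: "0 < L"
    and f: "\<And>x. 0 \<le> f x" "\<And>x. f x \<le> 1"
    and u: "\<And>x. 0 \<le> u x" "\<And>x. x \<notin> lattice_cube L \<Longrightarrow> u x = 0"
    and super: "\<And>x. x \<in> lattice_cube L \<Longrightarrow> u x \<le> f x + walk_op q u x"
    and pos: "\<And>x i. x \<in> lattice_cube L \<Longrightarrow> 0 < q x (Fwd i)"
  shows "(2 * u 0 / (CARD('d) * L)) ^ CARD('d) \<le> (\<Sum>x\<in>lattice_cube L. f x / (\<Prod>i\<in>UNIV. q x (Fwd i)))"
proof -
  \<comment> \<open>A linear function whose slopes are at most \<open>r\<close> in absolute value is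
    bounded by r d L = u 0 on the closed cube of radius \<open>L\<close>.\<close>
  define r where "r = u 0 / (CARD('d) * L)"
  \<comment> \<open>An affine function of slope s touching \<open>u\<close> from above at
    \<open>x\<close> satisfies u(x + e_i) - u x \<le> s_i \<le> u x - u(x - e_i); hence
    \<open>cbox (lo x) (hi x)\<close> contains every slope supporting at \<open>x\<close>.\<close>
  define lo hi where "lo x = (\<chi> i. u (x + axis i 1) - u x)" and "hi x = (\<chi> i. u x - u (x - axis i 1))"
    for x :: "int ^ 'd"
  have r: "0 \<le> r" "r * CARD('d) * L = u 0" using u(1)[of 0] L by (auto simp: r_def)
  have cover: "cbox (\<chi> i. - r) (\<chi> i. r) \<subseteq> (\<Union>x\<in>lattice_cube L. cbox (lo x) (hi x))"
  proof
    fix s :: "real ^ 'd" assume s: "s \<in> cbox (\<chi> i. - r) (\<chi> i. r)"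
    define v where "v x = u x - (\<Sum>i\<in>UNIV. s $ i * of_int (x $ i))" for x
    have zero: "0 \<in> (lattice_cube L :: (int ^ 'd) set)" using L by (simp add: lattice_cube_def)
    have "Max (v ` lattice_cube L) \<in> v ` lattice_cube L" using zero by (intro Max_in) auto
    then obtain x where x: "x \<in> lattice_cube L" and "v x = Max (v ` lattice_cube L)" by auto
    then have max: "v y \<le> v x" if "y \<in> lattice_cube L" for y using that by simp
    \<comment> \<open>Extends maximality to the closed cube, which contains all neighbours of
      \<open>x\<close>. Off the open cube \<open>u\<close> vanishes, and minus the linear part is at
      most u 0 = v 0 \<le> v x by the choice of \<open>r\<close>.\<close>
    have out: "v y \<le> v x" if y: "\<And>i. \<bar>y $ i\<bar> \<le> int L" for y
    proof (cases "y \<in> lattice_cube L")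
      case False
      have "- (s $ i * of_int (y $ i)) \<le> r * L" for i
      proof -
        have "- r \<le> s $ i \<and> s $ i \<le> r" using s by (simp add: mem_box_cart)
        then have "\<bar>s $ i\<bar> \<le> r" by linarith
        moreover have "\<bar>of_int (y $ i) :: real\<bar> \<le> L" using y[of i] by linarith
        ultimately have "\<bar>s $ i * of_int (y $ i)\<bar> \<le> r * L"
          by (simp add: abs_mult mult_mono r)
        then show ?thesis by linarith
      qed
      then have "(\<Sum>i\<in>UNIV. - (s $ i * of_int (y $ i))) \<le> (\<Sum>i\<in>(UNIV::'d set). r * L)"
        by (intro sum_mono)
      then have "v y \<le> u 0"
        using r(2) u(2)[OF False] by (simp add: v_def sum_negf algebra_simps)
      also have "u 0 = v 0" by (simp add: v_def)
      also have "v 0 \<le> v x" by (rule max[OF zero])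
      finally show ?thesis .
    qed (rule max)
    have ax: "(\<Sum>j\<in>UNIV. s $ j * of_int (axis i (1::int) $ j)) = s $ i" for i
      by (subst sum.remove[of _ i]) (auto simp: axis_def intro!: sum.neutral)
    have "lo x $ i \<le> s $ i \<and> s $ i \<le> hi x $ i" for i
    proof -
      have b: "\<bar>(x + axis i 1) $ j\<bar> \<le> int L" "\<bar>(x - axis i 1) $ j\<bar> \<le> int L" for j
        using x by (auto simp: lattice_cube_def axis_def dest!: spec[of _ j])
      from out[of "x + axis i 1", OF b(1)] out[of "x - axis i 1", OF b(2)] show ?thesis
        by (simp add: v_def lo_def hi_def algebra_simps sum.distrib sum_subtractf ax)
    qed
    then show "s \<in> (\<Union>x\<in>lattice_cube L. cbox (lo x) (hi x))"
      using x by (auto simp: mem_box_cart)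
  qed
  have box: "measure lborel (cbox (lo x) (hi x)) \<le> f x / (\<Prod>i\<in>UNIV. q x (Fwd i))"
    if x: "x \<in> lattice_cube L" for x
  proof (cases "cbox (lo x) (hi x) = {}")
    case True
    then show ?thesis using f by (simp add: divide_nonneg_nonneg prod_nonneg nonneg)
  next
    case False
    \<comment> \<open>\<open>b i\<close> is minus the second difference of \<open>u\<close> in
      direction \<open>i\<close>, nonnegative because the box is nonempty. The nonnegative terms q_i
      b_i sum to u x - P u x \<le> f x, so each of them is at most \<open>f x\<close>.\<close>
    define b where "b i = hi x $ i - lo x $ i" for i
    obtain s where "s \<in> cbox (lo x) (hi x)" using False by blast
    then have b: "0 \<le> b i" for i
      by (simp add: b_def mem_box_cart) (meson order_trans)
    have "(\<Sum>i\<in>UNIV. q x (Fwd i) * b i) = u x - walk_op q u x"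
      using walk_op_diff[of u x]
      by (simp add: b_def hi_def lo_def algebra_simps sum.distrib sum_subtractf sum_distrib_left)
    also have "\<dots> \<le> f x" using super[OF x] by simp
    finally have le: "(\<Sum>i\<in>UNIV. q x (Fwd i) * b i) \<le> f x" .
    have "q x (Fwd i) * b i \<le> f x" for i
      using le b by (intro order_trans[OF member_le_sum[of i UNIV "\<lambda>i. q x (Fwd i) * b i"]]) (auto simp: nonneg)
    then have "(\<Prod>i\<in>UNIV. q x (Fwd i) * b i) \<le> (\<Prod>i\<in>(UNIV::'d set). f x)"
      using b by (intro prod_mono) (auto simp: nonneg)
    also have "\<dots> = f x ^ CARD('d)" by simp
    also have "\<dots> \<le> f x ^ 1" using f[of x] by (intro power_decreasing) (auto simp: Suc_le_eq)
    finally have "(\<Prod>i\<in>UNIV. q x (Fwd i)) * (\<Prod>i\<in>UNIV. b i) \<le> f x"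
      by (simp add: prod.distrib)
    moreover have "measure lborel (cbox (lo x) (hi x)) = (\<Prod>i\<in>UNIV. b i)"
      unfolding b_def by (rule content_cbox_cart[OF False])
    ultimately show ?thesis
      using pos[OF x] by (simp add: le_divide_eq prod_pos mult.commute)
  qed
  have "(2 * r) ^ CARD('d) = measure lborel (cbox (\<chi> i. - r) (\<chi> i. r) :: (real ^ 'd) set)"
  proof -
    have "0 \<in> (cbox (\<chi> i. - r) (\<chi> i. r) :: (real ^ 'd) set)"
      using r by (simp add: mem_box_cart)
    then show ?thesis by (subst content_cbox_cart) auto
  qed
  also have "\<dots> \<le> measure lborel (\<Union>x\<in>lattice_cube L. cbox (lo x) (hi x))"
    using cover by (intro measure_mono_fmeasurable fmeasurable.finite_UN) auto
  also have "\<dots> \<le> (\<Sum>x\<in>lattice_cube L. measure lborel (cbox (lo x) (hi x)))"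
    by (intro measure_UNION_le) auto
  also have "\<dots> \<le> (\<Sum>x\<in>lattice_cube L. f x / (\<Prod>i\<in>UNIV. q x (Fwd i)))"
    by (intro sum_mono box)
  finally show ?thesis by (simp add: r_def)
qed

text \<open>The killed Green function satisfies the hypotheses of the maximum principle at every
  horizon, so the bound does not depend on \<open>n\<close>.\<close>

lemma killed_green_le:
  assumes "0 < L" "\<And>x. 0 \<le> f x" "\<And>x. f x \<le> 1"
    and "\<And>x i. x \<in> lattice_cube L \<Longrightarrow> 0 < q x (Fwd i)"
  shows "(2 * killed_green q L f n 0 / (CARD('d) * L)) ^ CARD('d)
    \<le> (\<Sum>x\<in>lattice_cube L. f x / (\<Prod>i\<in>UNIV. q x (Fwd i)))"
proof (rule discrete_maximum_principle)
  show "killed_green q L f n x = 0" if "x \<notin> lattice_cube L" for x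
    using that by (cases n) auto
qed (use assms killed_green_nonneg killed_green_le_step in auto)

text \<open>
  Compares the expected exit time with \<open>L\<^sup>2 - \<bar>x\<bar>\<^sup>2\<close>, the walk being a martingale with steps of
  length at most one.  The survival probability \<open>s\<close> makes up for stopping after \<open>L\<^sup>2\<close> steps.
\<close>

lemma killed_green_1_ge: "real L ^ 2 / 2 \<le> killed_green q L (\<lambda>_. 1) (L ^ 2) 0"
proof -
  \<comment> \<open>\<open>s n x\<close> is the probability that the walk from \<open>x\<close> is
    in the cube at the times 0, ..., n - 1; thus \<open>s 1\<close> is the indicator of the
    cube.\<close>
  define s where "s = rec_nat (\<lambda>_. 1) (\<lambda>_ h x. if x \<in> lattice_cube L then walk_op q h x else 0)"
  have s_0: "s 0 = (\<lambda>_. 1)" by (simp add: s_def)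
  have s_Suc: "s (Suc n) = (\<lambda>x. if x \<in> lattice_cube L then walk_op q (s n) x else 0)" for n
    unfolding s_def by simp
  let ?u = "killed_green q L (\<lambda>_. 1)"
  have s_nonneg: "0 \<le> s n x" for n x
  proof (induction n arbitrary: x)
    case (Suc n)
    from walk_op_mono[of "\<lambda>_. 0" "s n" x] Suc show ?case by (simp add: s_Suc walk_op_const)
  qed (simp add: s_0)
  have s_dec: "s (Suc n) x \<le> s n x" for n x
  proof (induction n arbitrary: x)
    case 0
    show ?case by (simp add: s_Suc s_0 walk_op_const)
  next
    case (Suc n)
    show ?case using walk_op_mono[OF Suc, where x=x] by (subst (1 2) s_Suc) simp
  qed
  \<comment> \<open>The larger horizon adds the reward at time \<open>n\<close>, collected exactly
    when the walk is in the cube at all times 0, ..., n; hence the index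
    \<open>Suc n\<close>.\<close>
  have u_eq: "?u (Suc n) x = ?u n x + s (Suc n) x" for n x
  proof (induction n arbitrary: x)
    case 0
    show ?case by (simp add: s_Suc s_0 walk_op_const)
  next
    case (Suc n)
    have "?u (Suc n) = (\<lambda>x. ?u n x + s (Suc n) x)" using Suc by blast
    then show ?case
      by (subst killed_green.simps(2)) (simp add: walk_op_add s_Suc[of "Suc n"])
  qed
  \<comment> \<open>\<open>?u n x\<close> is the sum of \<open>s k x\<close> over k = 1, ..., n, and
    \<open>s k x\<close> decreases in \<open>k\<close>.\<close>
  have n_s: "real n * s n x \<le> ?u n x" for n x
  proof (induction n)
    case (Suc n)
    have "real (Suc n) * s (Suc n) x \<le> real n * s n x + s (Suc n) x"
      using mult_left_mono[OF s_dec[of n x], of "real n"] by (simp add: algebra_simps)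
    also have "\<dots> \<le> ?u (Suc n) x" using Suc u_eq[of n x] by simp
    finally show ?case .
  qed simp
  define \<phi> where "\<phi> x = real L ^ 2 - (\<Sum>i\<in>UNIV. real_of_int (x $ i) ^ 2)" for x :: "int ^ 'd"
  have \<phi>_out: "\<phi> x \<le> 0" if "x \<notin> lattice_cube L" for x
  proof -
    from that obtain i where "int L \<le> \<bar>x $ i\<bar>" by (auto simp: lattice_cube_def not_less)
    then have "real L ^ 2 \<le> \<bar>real_of_int (x $ i)\<bar> ^ 2" by (intro power_mono) linarith+
    also have "\<dots> \<le> (\<Sum>i\<in>UNIV. real_of_int (x $ i) ^ 2)"
      using member_le_sum[of i UNIV "\<lambda>i. real_of_int (x $ i) ^ 2"] by simp
    finally show ?thesis by (simp add: \<phi>_def)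
  qed
  \<comment> \<open>The second difference of \<open>\<phi>\<close> is -2 in every direction, and the
    forward probabilities add up to at most 1/2.\<close>
  have \<phi>_step: "\<phi> x \<le> 1 + walk_op q \<phi> x" for x
  proof -
    have *: "(\<Sum>j\<in>UNIV. (real_of_int ((x + c) $ j))\<^sup>2) = (\<Sum>j\<in>UNIV. (real_of_int (x $ j))\<^sup>2)
       + 2 * (\<Sum>j\<in>UNIV. real_of_int (x $ j) * real_of_int (c $ j)) + (\<Sum>j\<in>UNIV. (real_of_int (c $ j))\<^sup>2)" for c
      by (simp add: power2_eq_square algebra_simps sum.distrib sum_distrib_left)
    have ax: "(\<Sum>j\<in>UNIV. (real_of_int (axis i (1::int) $ j))\<^sup>2) = 1" for i :: 'd
      by (subst sum.remove[of _ i]) (auto simp: axis_def intro!: sum.neutral)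
    have "\<phi> (x + axis i 1) + \<phi> (x - axis i 1) - 2 * \<phi> x = - 2" for i
      using *[of "axis i 1"] *[of "- axis i 1"] ax[of i] by (simp add: \<phi>_def sum_negf)
    then have "walk_op q \<phi> x - \<phi> x = - (2 * (\<Sum>i\<in>UNIV. q x (Fwd i)))"
      by (simp add: walk_op_diff sum_negf sum_distrib_left mult.commute)
    moreover have "2 * (\<Sum>i\<in>UNIV. q x (Fwd i)) \<le> 1"
      using sum_eq_1[of x] nonneg[of x Stay] by (simp add: sum_dir balanced)
    ultimately show ?thesis by linarith
  qed
  \<comment> \<open>At horizon \<open>n\<close> the walk either has left the cube, where \<phi>
    \<le> 0, or has survived, where \<phi> is at most L^2.\<close>
  have "\<phi> x \<le> ?u n x + real L ^ 2 * s n x" for n x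
  proof (induction n arbitrary: x)
    case 0
    show ?case by (simp add: s_0 \<phi>_def sum_nonneg)
  next
    case (Suc n)
    show ?case
    proof (cases "x \<in> lattice_cube L")
      case True
      have "walk_op q \<phi> x \<le> walk_op q (\<lambda>x. ?u n x + real L ^ 2 * s n x) x"
        by (intro walk_op_mono Suc)
      with True \<phi>_step[of x] show ?thesis
        by (simp add: s_Suc walk_op_add walk_op_cmult)
    next
      case False
      with \<phi>_out[of x] show ?thesis by (simp add: s_Suc)
    qed
  qed
  \<comment> \<open>With n = L^2 the two bounds combine to L^2 = \<phi> 0 \<le> u + L^2 s \<le> 2
    u.\<close>
  from this[of 0 "L ^ 2"] n_s[of "L ^ 2" 0] show ?thesis by (simp add: \<phi>_def)
qed

end

section \<open>Limits of sequences of functionals\<close>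

text \<open>Tychonoff's theorem gives a cluster point of the sequence of functionals. A single
  filter then serves all bounded sequences at once, whereas a diagonal subsequence handles only
  countably many \<open>f\<close>. Since \<open>G \<le> sequentially\<close>, ordinary limits
  persist along \<open>G\<close>.\<close>

lemma ex_generalized_limit:
  fixes S :: "nat \<Rightarrow> 'a \<Rightarrow> real"
  shows "\<exists>G. G \<noteq> bot \<and> G \<le> sequentially \<and> (\<forall>f. Bseq (\<lambda>n. S n f) \<longrightarrow> (\<exists>l. ((\<lambda>n. S n f) \<longlongrightarrow> l) G))"
proof -
  define T where "T n f = (if Bseq (\<lambda>n. S n f) then S n f else 0)" for n f
  have "\<exists>c. \<forall>n. \<bar>T n f\<bar> \<le> c" for f
  proof (cases "Bseq (\<lambda>n. S n f)")
    case True
    then obtain c where "\<And>n. \<bar>S n f\<bar> \<le> c" unfolding Bseq_def by auto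
    with True show ?thesis by (auto simp: T_def)
  next
    case False
    then show ?thesis by (auto simp: T_def)
  qed
  then obtain c where c: "\<And>n f. \<bar>T n f\<bar> \<le> c f" by metis
  have "compactin (product_topology (\<lambda>_. euclidean) UNIV) (PiE UNIV (\<lambda>f. {- c f..c f}))"
    by (subst compactin_PiE) auto
  then have K: "compact (PiE UNIV (\<lambda>f. {- c f..c f}))"
    by (simp add: euclidean_product_topology)
  have "filtermap T sequentially \<noteq> bot" by (simp add: filtermap_bot_iff)
  moreover have "eventually (\<lambda>x. x \<in> PiE UNIV (\<lambda>f. {- c f..c f})) (filtermap T sequentially)"
    using c by (auto simp: eventually_filtermap PiE_iff abs_le_iff minus_le_iff)
  ultimately obtain l where l: "inf (nhds l) (filtermap T sequentially) \<noteq> bot"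
    using K unfolding compact_filter by blast
  \<comment> \<open>The late indices at which \<open>T\<close> is near \<open>l\<close>. Properness
    of this filter says that every neighbourhood of \<open>l\<close> is visited infinitely
    often.\<close>
  define G where "G = inf sequentially (filtercomap T (nhds l))"
  have "G \<noteq> bot"
  proof
    assume "G = bot"
    then have "eventually (\<lambda>_. False) (inf sequentially (filtercomap T (nhds l)))"
      by (simp add: G_def)
    then obtain P R where "eventually P sequentially" "eventually R (nhds l)" "\<And>n. P n \<Longrightarrow> \<not> R (T n)"
      unfolding eventually_inf eventually_filtercomap by blast
    then have "eventually (\<lambda>y. \<not> R y) (filtermap T sequentially)"
      by (auto simp: eventually_filtermap elim: eventually_mono)
    with \<open>eventually R (nhds l)\<close> have "eventually (\<lambda>_. False) (inf (nhds l) (filtermap T sequentially))"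
      unfolding eventually_inf by blast
    with l show False by (simp add: eventually_False)
  qed
  moreover have "G \<le> sequentially" by (simp add: G_def)
  moreover have "((\<lambda>n. S n f) \<longlongrightarrow> l f) G" if f: "Bseq (\<lambda>n. S n f)" for f
  proof -
    have "filterlim T (nhds l) G"
      by (simp add: G_def filterlim_iff_le_filtercomap)
    from continuous_on_tendsto_compose[OF continuous_on_product_coordinates this, of f]
    have "((\<lambda>n. T n f) \<longlongrightarrow> l f) G" by simp
    then show ?thesis using f by (simp add: T_def)
  qed
  ultimately show ?thesis by blast
qed

text \<open>A Daniell-type representation. On indicators, \<open>cont\<close> is continuity at the
  empty set and yields countable additivity; the formula for functions follows by monotone
  approximation, with \<open>cont\<close> applied to the remainders.\<close>

lemma ex_measure_of_functional:
  fixes \<Lambda> :: "('a \<Rightarrow> real) \<Rightarrow> real" and M :: "'a measure"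
  defines "\<B> \<equiv> {g \<in> borel_measurable M. \<exists>c. \<forall>x\<in>space M. 0 \<le> g x \<and> g x \<le> c}"
  assumes nonneg: "\<And>g. g \<in> \<B> \<Longrightarrow> 0 \<le> \<Lambda> g"
    and add: "\<And>g h. g \<in> \<B> \<Longrightarrow> h \<in> \<B> \<Longrightarrow> \<Lambda> (\<lambda>x. g x + h x) = \<Lambda> g + \<Lambda> h"
    and cmult: "\<And>c g. 0 \<le> c \<Longrightarrow> g \<in> \<B> \<Longrightarrow> \<Lambda> (\<lambda>x. c * g x) = c * \<Lambda> g"
    and one: "\<Lambda> (indicator (space M)) = 1"
    and cont: "\<And>g c. (\<And>i. g i \<in> borel_measurable M) \<Longrightarrow> (\<And>i x. x \<in> space M \<Longrightarrow> 0 \<le> g i x \<and> g i x \<le> c) \<Longrightarrow>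
      (\<And>x. x \<in> space M \<Longrightarrow> (\<lambda>i. g i x) \<longlonglongrightarrow> 0) \<Longrightarrow> (\<lambda>i. \<Lambda> (g i)) \<longlonglongrightarrow> 0"
  shows "\<exists>\<nu>. prob_space \<nu> \<and> sets \<nu> = sets M \<and> (\<forall>g\<in>\<B>. integral\<^sup>L \<nu> g = \<Lambda> g)"
proof -
  have ind: "indicator A \<in> \<B>" if "A \<in> sets M" for A
    using that by (auto simp: \<B>_def indicator_def intro!: exI[of _ 1])
  define \<nu> where "\<nu> = measure_of (space M) (sets M) (\<lambda>A. ennreal (\<Lambda> (indicator A)))"
  have zero': "\<Lambda> (\<lambda>x. 0) = 0"
    using cmult[of 0 "indicator {}"] ind[of "{}"] by simp
  moreover have "indicator {} = (\<lambda>x::'a. 0::real)" by (simp add: fun_eq_iff)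
  ultimately have zero: "\<Lambda> (indicator {}) = 0" by simp
  have "countably_additive (sets M) (\<lambda>A. ennreal (\<Lambda> (indicator A)))"
  proof (rule sets.empty_continuous_imp_countably_additive)
    show "positive (sets M) (\<lambda>A. ennreal (\<Lambda> (indicator A)))"
      using zero by (simp add: positive_def)
    show "additive (sets M) (\<lambda>A. ennreal (\<Lambda> (indicator A)))"
      unfolding additive_def
    proof (intro ballI impI)
      fix A B assume AB: "A \<in> sets M" "B \<in> sets M" "A \<inter> B = {}"
      then have "(indicator (A \<union> B) :: 'a \<Rightarrow> real) = (\<lambda>x. indicator A x + indicator B x)"
        by (auto simp: indicator_def fun_eq_iff)
      then show "ennreal (\<Lambda> (indicator (A \<union> B))) = ennreal (\<Lambda> (indicator A)) + ennreal (\<Lambda> (indicator B))"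
        using AB by (simp add: add ind nonneg)
    qed
    fix A :: "nat \<Rightarrow> 'a set" assume A: "range A \<subseteq> sets M" "decseq A" "(\<Inter>i. A i) = {}"
    have "(\<lambda>i. \<Lambda> (indicator (A i))) \<longlonglongrightarrow> 0"
    proof (rule cont[where c=1])
      fix x
      obtain n where "x \<notin> A n" using A(3) by blast
      then have "indicator (A i) x = (0::real)" if "n \<le> i" for i
        using decseqD[OF A(2) that] by (auto simp: indicator_def)
      then show "(\<lambda>i. indicator (A i) x :: real) \<longlonglongrightarrow> 0"
        by (intro tendsto_eventually eventually_sequentiallyI[of n])
    qed (use A(1) in \<open>auto simp: indicator_def\<close>)
    from tendsto_ennrealI[OF this] show "(\<lambda>i. ennreal (\<Lambda> (indicator (A i)))) \<longlonglongrightarrow> 0"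
      by simp
  qed auto
  moreover have "positive (sets M) (\<lambda>A. ennreal (\<Lambda> (indicator A)))"
    using zero by (simp add: positive_def)
  ultimately have em: "emeasure \<nu> A = ennreal (\<Lambda> (indicator A))" if "A \<in> sets M" for A
    using that sets.sigma_algebra_axioms unfolding \<nu>_def by (intro emeasure_measure_of_sigma)
  have sets: "sets \<nu> = sets M" and space: "space \<nu> = space M"
    by (simp_all add: \<nu>_def)
  have prob: "prob_space \<nu>"
    by (rule prob_spaceI) (simp add: space em one)
  then interpret nu: prob_space \<nu> .
  have int: "integral\<^sup>L \<nu> g = \<Lambda> g" if g: "g \<in> borel_measurable M" "\<And>x. 0 \<le> g x" "\<forall>x\<in>space M. g x \<le> c" for g c
    using g
  proof (induction g arbitrary: c rule: borel_measurable_induct_real)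
    case (set A)
    then show ?case by (simp add: measure_def em nonneg ind sets)
  next
    case (mult u a)
    show ?case
    proof (cases "a = 0")
      case True
      with zero' show ?thesis by simp
    next
      case False
      with mult have "\<forall>x\<in>space M. u x \<le> c / a"
        by (auto simp: field_simps less_le)
      moreover have "u \<in> \<B>"
        using mult calculation by (auto simp: \<B>_def)
      ultimately show ?thesis using mult by (simp add: cmult)
    qed
  next
    case (add u v)
    have u: "\<forall>x\<in>space M. u x \<le> c" and v: "\<forall>x\<in>space M. v x \<le> c"
      using add by (auto intro: order_trans[rotated] add_increasing add_increasing2)
    then have B: "u \<in> \<B>" "v \<in> \<B>" using add by (auto simp: \<B>_def)
    have "integrable \<nu> u" "integrable \<nu> v"
      using u v add by (auto intro!: nu.integrable_const_bound[of _ c] simp: space measurable_cong_sets[OF sets refl])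
    then show ?case
      using add.IH u v B by (simp add: assms(3) add.commute)
  next
    case (seq U)
    have le: "U i x \<le> g x" if "x \<in> space M" for i x
      using seq.hyps(4)[OF that] seq.hyps(3) by (intro incseq_le) (auto simp: incseq_def le_fun_def)
    have le_c: "U i x \<le> c" if "x \<in> space M" for i x
      using order_trans[OF le[OF that]] seq.prems that by blast
    have U: "U i \<in> \<B>" for i
      using seq.hyps(1,2) le_c by (auto simp: \<B>_def intro!: exI[of _ c])
    have diff_c: "0 \<le> g x - U i x \<and> g x - U i x \<le> c" if "x \<in> space M" for i x
      using le[OF that, of i] seq.hyps(2)[of i x] seq.prems that by fastforce
    have g_meas: "g \<in> borel_measurable M"
      using seq.hyps(4) by (rule borel_measurable_LIMSEQ_real[OF _ seq.hyps(1)])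
    have diff: "(\<lambda>x. g x - U i x) \<in> \<B>" for i
      using seq.hyps(1) g_meas diff_c by (auto simp: \<B>_def simp del: diff_ge_0_iff_ge)
    \<comment> \<open>\<open>cont\<close> speaks only of sequences tending to 0, so the convergence
      of \<open>U i\<close> to \<open>g\<close> is expressed through the differences.\<close>
    have "(\<lambda>i. \<Lambda> (\<lambda>x. g x - U i x)) \<longlonglongrightarrow> 0"
    proof (rule cont[where c=c])
      show "(\<lambda>x. g x - U i x) \<in> borel_measurable M" for i
        using diff by (simp add: \<B>_def)
      show "0 \<le> g x - U i x \<and> g x - U i x \<le> c" if "x \<in> space M" for i x
        by (rule diff_c[OF that])
      show "(\<lambda>i. g x - U i x) \<longlonglongrightarrow> 0" if "x \<in> space M" for x
        using tendsto_diff[OF tendsto_const[of "g x"] seq.hyps(4)[OF that]] by simp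
    qed
    from tendsto_diff[OF tendsto_const[of "\<Lambda> g"] this]
    have "(\<lambda>i. \<Lambda> g - \<Lambda> (\<lambda>x. g x - U i x)) \<longlonglongrightarrow> \<Lambda> g" by simp
    moreover have "\<Lambda> g - \<Lambda> (\<lambda>x. g x - U i x) = integral\<^sup>L \<nu> (U i)" for i
    proof -
      have "\<Lambda> g = \<Lambda> (U i) + \<Lambda> (\<lambda>x. g x - U i x)"
        using assms(3)[OF U diff, of i i] by simp
      moreover have "integral\<^sup>L \<nu> (U i) = \<Lambda> (U i)"
        using seq.hyps(1,2) le_c by (intro seq.IH[of _ c]) auto
      ultimately show ?thesis by simp
    qed
    ultimately have "(\<lambda>i. integral\<^sup>L \<nu> (U i)) \<longlonglongrightarrow> \<Lambda> g" by simp
    moreover have "(\<lambda>i. integral\<^sup>L \<nu> (U i)) \<longlonglongrightarrow> integral\<^sup>L \<nu> g"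
    proof (rule integral_dominated_convergence[where w="\<lambda>_. c"])
      show "AE x in \<nu>. norm (U i x) \<le> c" for i
        using le_c seq.hyps(2) by (intro AE_I2) (auto simp: space)
    qed (use seq g_meas in \<open>auto simp: space measurable_cong_sets[OF sets refl]\<close>)
    ultimately show ?case by (blast intro: LIMSEQ_unique)
  qed
  have "integral\<^sup>L \<nu> g = \<Lambda> g" if g: "g \<in> \<B>" for g
  proof -
    from g obtain c where c: "\<And>x. x \<in> space M \<Longrightarrow> 0 \<le> g x \<and> g x \<le> c" and [measurable]: "g \<in> borel_measurable M"
      by (auto simp: \<B>_def)
    \<comment> \<open>The induction above needs nonnegativity on the whole type, so \<open>g\<close>
      is set to 0 off \<open>space M\<close>.\<close>
    define g' where "g' x = indicator (space M) x * g x" for x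
    have g': "g' \<in> borel_measurable M" "\<And>x. 0 \<le> g' x" "\<forall>x\<in>space M. g' x \<le> c"
      using c by (auto simp: g'_def[abs_def] indicator_def)
    have h: "(\<lambda>x. g x - g' x) \<in> \<B>"
      using g'(1) by (auto simp: \<B>_def g'_def)
    \<comment> \<open>\<open>\<Lambda>\<close> sees only the values on \<open>space M\<close>: a
      function vanishing there, taken as a constant sequence, satisfies the hypotheses of
      \<open>cont\<close>.\<close>
    have "(\<lambda>i::nat. \<Lambda> (\<lambda>x. g x - g' x)) \<longlonglongrightarrow> 0"
      using g'(1) by (intro cont[where c=0]) (auto simp: g'_def)
    then have "\<Lambda> (\<lambda>x. g x - g' x) = 0" by (simp add: LIMSEQ_const_iff)
    moreover have "g' \<in> \<B>" using g' by (auto simp: \<B>_def)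
    ultimately have "\<Lambda> g = \<Lambda> g'"
      using add[of g' "\<lambda>x. g x - g' x"] h by simp
    moreover have "integral\<^sup>L \<nu> g = integral\<^sup>L \<nu> g'"
      by (intro Bochner_Integration.integral_cong) (auto simp: g'_def space)
    ultimately show ?thesis using int[OF g'] by simp
  qed
  then show ?thesis using prob sets by blast
qed

section \<open>Laws of Markov chains and of environment paths\<close>

definition path_cylinder :: "(nat \<Rightarrow> 's) \<Rightarrow> nat \<Rightarrow> (nat \<Rightarrow> 's) set" where
  "path_cylinder x n = {X. \<forall>i\<le>n. X i = x i}"

text \<open>Two cylinders are nested or disjoint, according to whether their paths agree up to the
  smaller time.\<close>

lemma path_cylinder_Int:
  "path_cylinder x n \<inter> path_cylinder y m \<in> insert {} (range (\<lambda>(x, n). path_cylinder x n))"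
proof -
  have *: "path_cylinder x n \<inter> path_cylinder y m \<in> insert {} (range (\<lambda>(x, n). path_cylinder x n))"
    if "n \<le> m" for x y :: "nat \<Rightarrow> 'a" and n m
  proof (cases "\<forall>i\<le>n. x i = y i")
    case True
    then have "path_cylinder x n \<inter> path_cylinder y m = path_cylinder y m"
      using that by (auto simp: path_cylinder_def)
    then show ?thesis by (auto intro!: image_eqI[of _ _ "(y, m)"])
  next
    case False
    then have "path_cylinder x n \<inter> path_cylinder y m = {}"
      using that by (fastforce simp: path_cylinder_def)
    then show ?thesis by simp
  qed
  show ?thesis using *[of n m x y] *[of m n y x] by (cases "n \<le> m") (auto simp: Int_commute)
qed

lemma path_cylinder_sets:
  "path_cylinder x n \<in> sets (\<Pi>\<^sub>M i\<in>UNIV. count_space (UNIV :: 's::countable set))"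
proof -
  have "path_cylinder x n = {X \<in> space (\<Pi>\<^sub>M i\<in>UNIV. count_space (UNIV :: 's set)). \<forall>i\<le>n. X i \<in> {x i}}"
    by (auto simp: path_cylinder_def space_PiM)
  also have "\<dots> \<in> sets (\<Pi>\<^sub>M i\<in>UNIV. count_space (UNIV :: 's set))"
    by measurable
  finally show ?thesis .
qed

text \<open>Over a countable state space an event on coordinate \<open>i\<close> is a countable
  union of cylinders, one for each prefix up to time \<open>i\<close> that ends in the
  event.\<close>

lemma sets_PiM_path_cylinder:
  "sets (\<Pi>\<^sub>M i\<in>UNIV. count_space (UNIV :: 's::countable set)) =
     sigma_sets UNIV (insert {} (range (\<lambda>(x, n). path_cylinder x n)))" (is "sets ?M = sigma_sets _ ?G")
proof (rule antisym)
  have "{X. X i \<in> A} \<in> sigma_sets UNIV ?G" for i :: nat and A :: "'s set"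
  proof -
    let ?I = "PiE {..i} (\<lambda>_. UNIV :: 's set) \<inter> {x. x i \<in> A}"
    have "countable (PiE {..i} (\<lambda>_. UNIV :: 's set))" by (rule countable_PiE) auto
    then have "countable ?I" by (rule countable_subset[rotated]) auto
    moreover have "X \<in> (\<Union>x\<in>?I. path_cylinder x i)" if "X i \<in> A" for X
      using that by (intro UN_I[of "restrict X {..i}"]) (auto simp: path_cylinder_def)
    then have "{X. X i \<in> A} = (\<Union>x\<in>?I. path_cylinder x i)"
      by (auto simp: path_cylinder_def)
    moreover have "path_cylinder x i \<in> sigma_sets UNIV ?G" for x :: "nat \<Rightarrow> 's"
      by (rule sigma_sets.Basic) (auto intro!: image_eqI[of _ _ "(x, i)"])
    ultimately show ?thesis
      using sigma_sets_UNION[of "(\<lambda>x. path_cylinder x i) ` ?I" UNIV ?G] by fastforce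
  qed
  then show "sets ?M \<subseteq> sigma_sets UNIV ?G"
    unfolding sets_PiM_single by (auto intro!: sigma_sets_mono simp: PiE_UNIV_domain)
  have "sigma_sets (space ?M) ?G \<subseteq> sets ?M"
    by (rule sets.sigma_sets_subset) (auto intro: path_cylinder_sets)
  then show "sigma_sets UNIV ?G \<subseteq> sets ?M" by (simp add: space_PiM)
qed

text \<open>The cylinders and the empty set form an intersection-stable generator, and the countably
  many cylinders of time 0 cover the path space.\<close>

lemma path_measure_eqI:
  fixes M N :: "(nat \<Rightarrow> 's::countable) measure"
  assumes sets: "sets M = sets (\<Pi>\<^sub>M i\<in>UNIV. count_space UNIV)" "sets N = sets (\<Pi>\<^sub>M i\<in>UNIV. count_space UNIV)"
    and "finite_measure M"
    and eq: "\<And>x n. emeasure M (path_cylinder x n) = emeasure N (path_cylinder x n)"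
  shows "M = N"
proof (rule measure_eqI_generator_eq_countable[where \<Omega>=UNIV
      and E="insert {} (range (\<lambda>(x, n). path_cylinder x n))" and A="range (\<lambda>a. path_cylinder (\<lambda>_. a) 0)"])
  show "Int_stable (insert {} (range (\<lambda>(x :: nat \<Rightarrow> 's, n). path_cylinder x n)))"
  proof (rule Int_stableI)
    fix a b :: "(nat \<Rightarrow> 's) set"
    assume "a \<in> insert {} (range (\<lambda>(x, n). path_cylinder x n))"
      "b \<in> insert {} (range (\<lambda>(x, n). path_cylinder x n))"
    then consider "a \<inter> b = {}" | x n y m where "a = path_cylinder x n" "b = path_cylinder y m"
      by auto
    then show "a \<inter> b \<in> insert {} (range (\<lambda>(x, n). path_cylinder x n))"
    proof cases
      case 2
      then show ?thesis by (simp only: path_cylinder_Int)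
    qed simp
  qed
  show "(\<Union> (range (\<lambda>a. path_cylinder (\<lambda>_. a) 0))) = (UNIV :: (nat \<Rightarrow> 's) set)"
    by (auto simp: path_cylinder_def)
qed (auto simp: eq sets sets_PiM_path_cylinder finite_measure.emeasure_finite[OF assms(3)]
          intro!: image_eqI[of _ _ "(_, 0)"])

lemma Ionescu_Tulcea_markov_chain:
  assumes "prob_space \<nu>" "sets \<nu> = sets M"
    and K: "K \<in> measurable M (subprob_algebra M)" "\<And>x. x \<in> space M \<Longrightarrow> prob_space (K x)"
  shows "Ionescu_Tulcea (\<lambda>n X. if n = 0 then \<nu> else K (X (n - 1))) (\<lambda>_. M)"
proof (rule Ionescu_Tulcea.intro)
  have "\<nu> \<in> space (subprob_algebra M)"
    using assms by (simp add: space_subprob_algebra prob_space_imp_subprob_space)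
  then show "(\<lambda>X. if i = 0 then \<nu> else K (X (i - 1))) \<in> measurable (Pi\<^sub>M {0..<i} (\<lambda>_. M)) (subprob_algebra M)"
    for i :: nat
    by (cases "i = 0") (auto intro!: measurable_compose[OF _ K(1)] measurable_component_singleton)
  show "prob_space (if i = 0 then \<nu> else K (x (i - 1)))" if "x \<in> space (Pi\<^sub>M {0..<i} (\<lambda>_. M))" for i :: nat and x
    using that assms by (auto simp: space_PiM PiE_iff)
qed

text \<open>Each Ionescu-Tulcea extension appends one coordinate and so multiplies the mass of a
  cylinder by one transition probability; the projective limit agrees with the finite
  stages.\<close>

lemma markov_chain_law_path_cylinder:
  fixes K :: "'s::countable \<Rightarrow> 's measure"
  assumes \<nu>: "prob_space \<nu>" "sets \<nu> = UNIV"
    and K: "\<And>x. prob_space (K x)" "\<And>x. sets (K x) = UNIV"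
  shows "prob_space (markov_chain_law (count_space UNIV) \<nu> K)"
    and "sets (markov_chain_law (count_space UNIV) \<nu> K) = sets (\<Pi>\<^sub>M i\<in>UNIV. count_space UNIV)"
    and "emeasure (markov_chain_law (count_space UNIV) \<nu> K) (path_cylinder x n) =
      emeasure \<nu> {x 0} * (\<Prod>i<n. emeasure (K (x i)) {x (Suc i)})"
proof -
  have Km: "K \<in> measurable (count_space UNIV) (subprob_algebra (count_space UNIV))"
    using K by (auto simp: space_subprob_algebra prob_space_imp_subprob_space)
  interpret IT: Ionescu_Tulcea "\<lambda>n X. if n = 0 then \<nu> else K (X (n - 1))" "\<lambda>_. count_space UNIV"
    by (rule Ionescu_Tulcea_markov_chain) (use \<nu> K Km in auto)
  have law: "markov_chain_law (count_space UNIV) \<nu> K = IT.PF.lim"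
    by (simp add: markov_chain_law_def)
  show sets: "sets (markov_chain_law (count_space UNIV) \<nu> K) = sets (\<Pi>\<^sub>M i\<in>UNIV. count_space UNIV)"
    by (simp add: law)
  \<comment> \<open>The product over the empty index set is one point, whose embedding is the whole
    path space; this computes the total mass.\<close>
  have "emeasure IT.PF.lim (IT.PF.emb UNIV {} {\<lambda>_. undefined}) = emeasure (IT.CI {}) {\<lambda>_. undefined}"
    by (rule IT.lim) (auto simp: PiM_empty)
  also have "\<dots> = 1"
    using prob_space.emeasure_space_1[OF IT.PF.prob_space_P[of "{}"]] by (simp add: IT.PF.space_P PiM_empty)
  also have "IT.PF.emb UNIV {} {\<lambda>_. undefined} = UNIV"
    by (auto simp: prod_emb_def restrict_def)
  finally show "prob_space (markov_chain_law (count_space UNIV) \<nu> K)"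
    unfolding law by (intro prob_spaceI) (simp add: space_PiM)
  define A where "A n = PiE {0..<Suc n} (\<lambda>i. {x i})" for n
  have A: "A n \<in> sets (Pi\<^sub>M {0..<Suc n} (\<lambda>_. count_space UNIV))" for n
    unfolding A_def by (intro sets_PiM_I_finite) auto
  have space0: "(\<lambda>_. undefined) \<in> space (Pi\<^sub>M {0..<0::nat} (\<lambda>_. count_space UNIV))"
    by (simp add: space_PiM)
  have C: "emeasure (IT.C 0 (Suc n) (\<lambda>_. undefined)) (A n) =
      emeasure \<nu> {x 0} * (\<Prod>i<n. emeasure (K (x i)) {x (Suc i)})" for n
  proof (induction n)
    case 0
    have "IT.C 0 (Suc 0) (\<lambda>_. undefined) = IT.eP 0 (\<lambda>_. undefined)"
      unfolding IT.C.simps add_0 by (rule bind_return[OF IT.measurable_eP space0])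
    then have "emeasure (IT.C 0 (Suc 0) (\<lambda>_. undefined)) (A 0) = emeasure (IT.eP 0 (\<lambda>_. undefined)) (A 0)"
      by (rule arg_cong)
    also have "\<dots> = emeasure \<nu> ((\<lambda>y. (\<lambda>_. undefined)(0 := y)) -` A 0 \<inter> UNIV)"
      unfolding IT.emeasure_eP[OF space0 A] by (simp only: simp_thms if_True space_count_space)
    also have "(\<lambda>y. (\<lambda>_. undefined)(0 := y)) -` A 0 \<inter> UNIV = {x 0}"
    proof -
      have "(\<lambda>_. undefined)(0 := y) \<in> A 0 \<longleftrightarrow> y = x 0" for y
        by (simp add: A_def PiE_iff extensional_def)
      then show ?thesis by (simp add: vimage_def)
    qed
    finally show ?case by (simp only: lessThan_0 prod.empty mult_1_right)
  next
    case (Suc n)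
    let ?C = "IT.C 0 (Suc n) (\<lambda>_. undefined)"
    \<comment> \<open>The extended path lies in \<open>A (Suc n)\<close> only if \<open>X\<close>
      lies in \<open>A n\<close>, and then its last state is \<open>x n\<close>, so that the kernel
      no longer depends on \<open>X\<close>.\<close>
    have *: "emeasure (IT.eP (Suc n) X) (A (Suc n)) = emeasure (K (x n)) {x (Suc n)} * indicator (A n) X"
      if X: "X \<in> space ?C" for X
    proof -
      have X': "X \<in> space (Pi\<^sub>M {0..<Suc n} (\<lambda>_. count_space UNIV))"
        using X IT.space_C[OF space0, of "Suc n"] by simp
      have "emeasure (IT.eP (Suc n) X) (A (Suc n)) = emeasure (K (X n)) ((\<lambda>y. X(Suc n := y)) -` A (Suc n) \<inter> UNIV)"
        unfolding IT.emeasure_eP[OF X' A] by (simp only: nat.distinct simp_thms if_False diff_Suc_1 space_count_space)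
      also have "(\<lambda>y. X(Suc n := y)) -` A (Suc n) \<inter> UNIV = (if X \<in> A n then {x (Suc n)} else {})"
      proof -
        have "X(Suc n := y) \<in> A (Suc n) \<longleftrightarrow> y = x (Suc n) \<and> X \<in> A n" for y
          using X' unfolding A_def atLeastLessThanSuc[of 0 "Suc n"]
          by (auto simp: PiE_iff space_PiM extensional_def)
        then show ?thesis by auto
      qed
      also have "emeasure (K (X n)) \<dots> = emeasure (K (x n)) {x (Suc n)} * indicator (A n) X"
        by (simp add: A_def PiE_iff)
      finally show ?thesis .
    qed
    have sets_C: "sets ?C = sets (Pi\<^sub>M {0..<Suc n} (\<lambda>_. count_space UNIV))"
      using IT.sets_C[OF space0, of "Suc n"] by (simp only: add_0)
    have "emeasure (IT.C 0 (Suc (Suc n)) (\<lambda>_. undefined)) (A (Suc n)) =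
        (\<integral>\<^sup>+X. emeasure (IT.eP (Suc n) X) (A (Suc n)) \<partial>?C)"
      unfolding IT.C.simps(2)[of 0 "Suc n"] add_0
    proof (rule emeasure_bind[OF _ _ A])
      show "space ?C \<noteq> {}"
        by (rule prob_space.not_empty[OF IT.prob_space_C[OF space0]])
      show "IT.eP (Suc n) \<in> measurable ?C (subprob_algebra (Pi\<^sub>M {0..<Suc (Suc n)} (\<lambda>_. count_space UNIV)))"
        using IT.measurable_eP[of "Suc n"] by (simp only: measurable_cong_sets[OF sets_C refl])
    qed
    also have "\<dots> = (\<integral>\<^sup>+X. emeasure (K (x n)) {x (Suc n)} * indicator (A n) X \<partial>?C)"
      by (intro nn_integral_cong *)
    also have "\<dots> = emeasure (K (x n)) {x (Suc n)} * emeasure ?C (A n)"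
      by (rule nn_integral_cmult_indicator) (simp only: sets_C A)
    finally show ?case unfolding Suc prod.lessThan_Suc by (simp only: mult.commute mult.left_commute)
  qed
  have "path_cylinder x n = IT.PF.emb UNIV {0..<Suc n} (A n)"
  proof (rule set_eqI)
    show "X \<in> path_cylinder x n \<longleftrightarrow> X \<in> IT.PF.emb UNIV {0..<Suc n} (A n)" for X
      by (auto simp: path_cylinder_def prod_emb_iff A_def PiE_iff less_Suc_eq_le)
  qed
  then have "emeasure IT.PF.lim (path_cylinder x n) = emeasure (IT.CI {0..<Suc n}) (A n)"
    by (simp only: IT.lim[OF finite_atLeastLessThan A])
  also have "\<dots> = emeasure (IT.C 0 (Suc n) (\<lambda>_. undefined)) (IT.PF.emb {0..<Suc n} {0..<Suc n} (A n))"
    by (rule IT.emeasure_CI[OF subset_refl A])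
  also have "IT.PF.emb {0..<Suc n} {0..<Suc n} (A n) = A n"
    by (rule prod_emb_id) (auto simp: A_def PiE_iff)
  finally  show "emeasure (markov_chain_law (count_space UNIV) \<nu> K) (path_cylinder x n) =
      emeasure \<nu> {x 0} * (\<Prod>i<n. emeasure (K (x i)) {x (Suc i)})"
    by (simp only: law C)
qed

section \<open>Shifts of environments and measurability\<close>

lemma shift_0 [simp]: "shift 0 \<omega> = \<omega>"
  by (simp add: shift_def)

lemma shift_add: "shift (x + y) \<omega> = shift y (shift x \<omega>)"
  by (simp add: shift_def add.assoc)

lemma shift_apply_0: "shift x \<omega> 0 = \<omega> x"
  by (simp add: shift_def)

lemma space_env_borel: "space env_borel = {\<omega>. \<forall>x. \<omega> x \<in> prob_simplex}"
  by (simp add: env_borel_def space_restrict_space)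

lemma shift_in_space: "\<omega> \<in> space env_borel \<Longrightarrow> shift x \<omega> \<in> space env_borel"
  by (simp add: space_env_borel shift_def)

lemma shift_in_space_iff [simp]: "shift x \<omega> \<in> space env_borel \<longleftrightarrow> \<omega> \<in> space env_borel"
proof
  assume "shift x \<omega> \<in> space env_borel"
  then have "shift (- x) (shift x \<omega>) \<in> space env_borel" by (rule shift_in_space)
  then show "\<omega> \<in> space env_borel" by (simp add: shift_def)
qed (rule shift_in_space)

text \<open>\<open>env_borel\<close> is a trace of the Borel algebra of the product topology, so
  measurability is obtained from continuity of the coordinates.\<close>

lemma measurable_shift [measurable]: "shift x \<in> measurable env_borel env_borel"
proof -
  have "continuous_on UNIV (shift x :: 'a environment \<Rightarrow> _)"
    unfolding shift_def
    by (intro continuous_on_coordinatewise_then_product continuous_on_product_coordinates)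
  then have "shift x \<in> measurable borel (borel :: 'a environment measure)"
    by (rule borel_measurable_continuous_onI)
  then show ?thesis
    unfolding env_borel_def
    by (intro measurable_restrict_space2 measurable_restrict_space1)
       (auto simp: space_restrict_space shift_def)
qed

lemma measurable_eval: "(\<lambda>\<omega>. \<omega> x) \<in> measurable env_borel simplex_borel"
  unfolding env_borel_def simplex_borel_def
  by (intro measurable_restrict_space2 measurable_restrict_space1 borel_measurable_continuous_onI
        continuous_on_product_coordinates) (auto simp: space_restrict_space)

abbreviation lattice_paths :: "(nat \<Rightarrow> int ^ 'd::finite) measure" where
  "lattice_paths \<equiv> \<Pi>\<^sub>M n\<in>UNIV. count_space UNIV"

abbreviation env_paths :: "(nat \<Rightarrow> 'd::finite environment) measure" where
  "env_paths \<equiv> \<Pi>\<^sub>M n\<in>UNIV. env_borel"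

locale environment_function =
  fixes \<E> :: "('d::finite dir \<Rightarrow> real) \<Rightarrow> ('d dir \<Rightarrow> real)"
  assumes measurable_\<E>: "\<E> \<in> measurable simplex_borel simplex_borel"
begin

lemma measurable_prob [measurable]: "(\<lambda>\<omega>. \<E> (\<omega> x) k) \<in> borel_measurable env_borel"
proof -
  have "(\<lambda>p. p k) \<in> borel_measurable (simplex_borel :: ('d dir \<Rightarrow> real) measure)"
    unfolding simplex_borel_def
    by (intro measurable_restrict_space1 borel_measurable_continuous_onI continuous_on_product_coordinates)
  from measurable_compose[OF measurable_compose[OF measurable_eval measurable_\<E>] this] show ?thesis .
qed

lemma prob_in_simplex: "\<omega> \<in> space env_borel \<Longrightarrow> \<E> (\<omega> x) \<in> prob_simplex"
  using measurable_space[OF measurable_\<E>, of "\<omega> x"]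
  by (simp add: simplex_borel_def space_restrict_space space_env_borel)

lemma prob_nonneg: "\<omega> \<in> space env_borel \<Longrightarrow> 0 \<le> \<E> (\<omega> x) k"
  using prob_in_simplex[of \<omega> x] by (simp add: prob_simplex_def)

lemma sum_prob: "\<omega> \<in> space env_borel \<Longrightarrow> (\<Sum>k\<in>UNIV. \<E> (\<omega> x) k) = 1"
  using prob_in_simplex[of \<omega> x] by (simp add: prob_simplex_def)

lemma sum_ennreal_prob: "\<omega> \<in> space env_borel \<Longrightarrow> (\<Sum>k\<in>UNIV. ennreal (\<E> (\<omega> x) k)) = 1"
  by (simp add: sum_ennreal prob_nonneg sum_prob)

section \<open>The walk in a fixed environment and its Markov property\<close>

lemma walk_kernel:
  assumes \<omega>: "\<omega> \<in> space env_borel"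
  shows "prob_space (walk_kernel \<E> \<omega> x)" "sets (walk_kernel \<E> \<omega> x) = UNIV"
    and "emeasure (walk_kernel \<E> \<omega> x) {y} = (\<Sum>k\<in>{k. x + step k = y}. ennreal (\<E> (\<omega> x) k))"
proof -
  have m: "(\<lambda>k. x + step k) \<in> measurable (point_measure UNIV (\<lambda>k. ennreal (\<E> (\<omega> x) k))) (count_space UNIV)"
    by simp
  have "prob_space (point_measure UNIV (\<lambda>k. ennreal (\<E> (\<omega> x) k)))"
    by (rule prob_spaceI) (simp add: emeasure_point_measure_finite space_point_measure sum_ennreal_prob \<omega>)
  then show "prob_space (walk_kernel \<E> \<omega> x)"
    unfolding walk_kernel_def by (rule prob_space.prob_space_distr[OF _ m])
  show "sets (walk_kernel \<E> \<omega> x) = UNIV"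
    by (simp add: walk_kernel_def)
  show "emeasure (walk_kernel \<E> \<omega> x) {y} = (\<Sum>k\<in>{k. x + step k = y}. ennreal (\<E> (\<omega> x) k))"
    unfolding walk_kernel_def
    by (subst emeasure_distr[OF m]) (auto simp: emeasure_point_measure_finite space_point_measure vimage_def)
qed

lemma walk_law:
  assumes \<omega>: "\<omega> \<in> space env_borel"
  shows "prob_space (walk_law \<E> \<omega>)" "sets (walk_law \<E> \<omega>) = sets lattice_paths"
    and "emeasure (walk_law \<E> \<omega>) (path_cylinder x n) =
      indicator {0} (x 0) * (\<Prod>i<n. \<Sum>k\<in>{k. x i + step k = x (Suc i)}. ennreal (\<E> (\<omega> (x i)) k))"
  using markov_chain_law_path_cylinder[of "return (count_space UNIV) 0" "walk_kernel \<E> \<omega>"]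
  by (simp_all add: walk_law_def walk_kernel[OF \<omega>] prob_space_return indicator_def)

lemma space_walk_law: "\<omega> \<in> space env_borel \<Longrightarrow> space (walk_law \<E> \<omega>) = UNIV"
  by (subst sets_eq_imp_space_eq[OF walk_law(2)]) (simp_all add: space_PiM)

lemma measurable_coordinate:
  assumes "\<omega> \<in> space env_borel"
  shows "(\<lambda>X. X n) \<in> measurable (walk_law \<E> \<omega>) (count_space UNIV)"
  unfolding measurable_cong_sets[OF walk_law(2)[OF assms] refl]
  by (rule measurable_component_singleton) simp

text \<open>The Markov property at time one: after the step \<open>k\<close> the walk, recentred at
  its new position, is the walk from 0 in the environment \<open>shift (step k) \<omega>\<close>,
  and \<open>case_nat\<close> prepends the origin. Both sides are measures in \<open>D\<close>, so
  it is enough to compare them on cylinders.\<close>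

lemma walk_law_first_step:
  assumes \<omega>: "\<omega> \<in> space env_borel" and D: "D \<in> sets lattice_paths"
  shows "emeasure (walk_law \<E> \<omega>) D =
    (\<Sum>k\<in>UNIV. ennreal (\<E> (\<omega> 0) k) *
      emeasure (walk_law \<E> (shift (step k) \<omega>)) {X. case_nat 0 (\<lambda>n. step k + X n) \<in> D})"
proof -
  let ?T = "\<lambda>k X. case_nat 0 (\<lambda>n. step k + X n)"
  let ?N = "\<lambda>k. distr (walk_law \<E> (shift (step k) \<omega>)) lattice_paths (?T k)"
  define p where "p = point_measure UNIV (\<lambda>k. ennreal (\<E> (\<omega> 0) k))"
  have T: "?T k \<in> measurable (walk_law \<E> (shift (step k) \<omega>)) lattice_paths" for k
  proof (rule measurable_abs_UNIV)
    fix n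
    have "(\<lambda>X. step k + X m) \<in> measurable (walk_law \<E> (shift (step k) \<omega>)) (count_space UNIV)" for m
      using \<omega> by (intro measurable_compose[OF measurable_coordinate]) auto
    then show "(\<lambda>X. ?T k X n) \<in> measurable (walk_law \<E> (shift (step k) \<omega>)) (count_space UNIV)"
      by (cases n) auto
  qed
  have N: "?N \<in> measurable p (subprob_algebra lattice_paths)"
    using prob_space.prob_space_distr[OF walk_law(1) T] \<omega>
    by (auto simp: p_def measurable_point_measure_eq1 space_subprob_algebra prob_space_imp_subprob_space)
  have mix: "emeasure (p \<bind> ?N) A = (\<Sum>k\<in>UNIV. ennreal (\<E> (\<omega> 0) k) *
      emeasure (walk_law \<E> (shift (step k) \<omega>)) {X. ?T k X \<in> A})" if A: "A \<in> sets lattice_paths" for A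
  proof -
    have "emeasure (p \<bind> ?N) A = (\<integral>\<^sup>+k. emeasure (?N k) A \<partial>p)"
      by (rule emeasure_bind[OF _ N A]) (simp add: p_def space_point_measure)
    also have "\<dots> = (\<Sum>k\<in>UNIV. ennreal (\<E> (\<omega> 0) k) * emeasure (?N k) A)"
      by (simp add: p_def nn_integral_point_measure_finite)
    finally show ?thesis
      using \<omega> by (simp add: emeasure_distr[OF T A] space_walk_law vimage_def)
  qed
  have "walk_law \<E> \<omega> = p \<bind> ?N"
  proof (rule path_measure_eqI)
    show "sets (p \<bind> ?N) = sets lattice_paths"
      by (rule sets_bind[where N=lattice_paths]) (auto simp: p_def space_point_measure)
    show "finite_measure (walk_law \<E> \<omega>)"
      using walk_law(1)[OF \<omega>] by (simp add: prob_space_def)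
    fix x :: "nat \<Rightarrow> int ^ 'd" and n
    show "emeasure (walk_law \<E> \<omega>) (path_cylinder x n) = emeasure (p \<bind> ?N) (path_cylinder x n)"
    proof (cases "x 0 = 0")
      case False
      then have "{X. ?T k X \<in> path_cylinder x n} = {}" for k
        by (auto simp: path_cylinder_def dest!: spec[of _ 0])
      with False show ?thesis
        by (simp add: mix path_cylinder_sets walk_law(3)[OF \<omega>])
    next
      case x0: True
      show ?thesis
      proof (cases n)
        case 0
        have "{X. ?T k X \<in> path_cylinder x 0} = UNIV" for k
          using x0 by (auto simp: path_cylinder_def)
        moreover have "emeasure (walk_law \<E> (shift (step k) \<omega>)) UNIV = 1" for k
          using prob_space.emeasure_space_1[OF walk_law(1)] \<omega> by (metis shift_in_space space_walk_law)
        ultimately show ?thesis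
          using x0 by (simp add: 0 mix path_cylinder_sets walk_law(3)[OF \<omega>] sum_ennreal_prob[OF \<omega>])
      next
        case (Suc m)
        \<comment> \<open>The tail of the path \<open>x\<close>, recentred by \<open>step k\<close>.
          It starts at 0 exactly when the step \<open>k\<close> leads from \<open>x 0\<close> to
          \<open>x (Suc 0)\<close>; otherwise its cylinder has mass 0.\<close>
        let ?y = "\<lambda>k i. x (Suc i) - step k"
        let ?R = "\<Prod>i<m. \<Sum>j\<in>{j. x (Suc i) + step j = x (Suc (Suc i))}. ennreal (\<E> (\<omega> (x (Suc i))) j)"
        have "{X. ?T k X \<in> path_cylinder x n} = path_cylinder (?y k) m" for k
        proof -
          have "?T k X \<in> path_cylinder x n \<longleftrightarrow> (\<forall>i\<le>m. step k + X i = x (Suc i))" for X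
          proof
            assume *: "?T k X \<in> path_cylinder x n"
            have "step k + X i = x (Suc i)" if "i \<le> m" for i
              using * that unfolding path_cylinder_def Suc by (auto dest: spec[of _ "Suc i"])
            then show "\<forall>i\<le>m. step k + X i = x (Suc i)" by blast
          next
            assume "\<forall>i\<le>m. step k + X i = x (Suc i)"
            then show "?T k X \<in> path_cylinder x n"
              using x0 by (auto simp: path_cylinder_def Suc split: nat.split)
          qed
          then show ?thesis by (auto simp: path_cylinder_def algebra_simps)
        qed
        moreover have "emeasure (walk_law \<E> (shift (step k) \<omega>)) (path_cylinder (?y k) m) =
            indicator {k. x 0 + step k = x (Suc 0)} k * ?R" for k
        proof -
          have *: "?y k i + step j = ?y k (Suc i) \<longleftrightarrow> x (Suc i) + step j = x (Suc (Suc i))" for i j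
            by (auto simp: algebra_simps)
          have "shift (step k) \<omega> (?y k i) = \<omega> (x (Suc i))" for i
            by (simp add: shift_def)
          then show ?thesis
            using \<omega> x0 by (auto simp: walk_law(3) * indicator_def)
        qed
        ultimately have "emeasure (p \<bind> ?N) (path_cylinder x n) =
            (\<Sum>k\<in>UNIV. ennreal (\<E> (\<omega> 0) k) * (indicator {k. x 0 + step k = x (Suc 0)} k * ?R))"
          by (simp add: mix path_cylinder_sets)
        also have "\<dots> = (\<Sum>k\<in>{k. x 0 + step k = x (Suc 0)}. ennreal (\<E> (\<omega> (x 0)) k)) * ?R"
          unfolding sum_distrib_right using x0
          by (intro sum.mono_neutral_cong_right) auto
        also have "\<dots> = emeasure (walk_law \<E> \<omega>) (path_cylinder x n)"
          using x0 by (simp add: walk_law(3)[OF \<omega>] Suc prod.lessThan_Suc_shift del: prod.lessThan_Suc)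
        finally show ?thesis by simp
      qed
    qed
  qed (use walk_law \<omega> in auto)
  with mix[OF D] show ?thesis by simp
qed

section \<open>The environment seen from the walk, started at a fixed environment\<close>

definition env_path_law :: "'d environment \<Rightarrow> (nat \<Rightarrow> 'd environment) measure" where
  "env_path_law \<omega> = distr (walk_law \<E> \<omega>) env_paths (\<lambda>X n. shift (X n) \<omega>)"

lemma sets_env_path_law [simp]: "sets (env_path_law \<omega>) = sets env_paths"
  by (simp add: env_path_law_def)

lemma measurable_env_path:
  assumes \<omega>: "\<omega> \<in> space env_borel"
  shows "(\<lambda>X n. shift (X n) \<omega>) \<in> measurable (walk_law \<E> \<omega>) env_paths"
proof (rule measurable_abs_UNIV)
  fix n
  show "(\<lambda>X. shift (X n) \<omega>) \<in> measurable (walk_law \<E> \<omega>) env_borel"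
    using \<omega> by (intro measurable_compose[OF measurable_coordinate[OF \<omega>], of "\<lambda>x. shift x \<omega>"]) simp
qed

lemma prob_space_env_path_law: "\<omega> \<in> space env_borel \<Longrightarrow> prob_space (env_path_law \<omega>)"
  unfolding env_path_law_def by (intro prob_space.prob_space_distr walk_law measurable_env_path)

text \<open>The Markov property of the walk, pushed forward: composing shifts absorbs the position
  of the walk into the environment, so the first step simply replaces \<open>\<omega>\<close> by
  \<open>shift (step k) \<omega>\<close>.\<close>

lemma env_path_law_first_step:
  assumes \<omega>: "\<omega> \<in> space env_borel" and D: "D \<in> sets env_paths"
  shows "emeasure (env_path_law \<omega>) D =
    (\<Sum>k\<in>UNIV. ennreal (\<E> (\<omega> 0) k) *
      emeasure (env_path_law (shift (step k) \<omega>)) {Y \<in> space env_paths. case_nat \<omega> Y \<in> D})"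
proof -
  let ?D = "{X. (\<lambda>n. shift (X n) \<omega>) \<in> D}"
  have D': "?D \<in> sets lattice_paths"
    using measurable_sets[OF measurable_env_path[OF \<omega>] D] \<omega> by (simp add: walk_law space_walk_law vimage_def)
  have case_nat_measurable: "case_nat \<omega> \<in> measurable env_paths env_paths"
  proof (rule measurable_abs_UNIV)
    show "(\<lambda>Y. case_nat \<omega> Y n) \<in> measurable env_paths env_borel" for n
      using \<omega> by (cases n) auto
  qed
  have sets: "{Y \<in> space env_paths. case_nat \<omega> Y \<in> D} \<in> sets env_paths"
    using measurable_sets[OF case_nat_measurable D] by (simp add: vimage_def Int_def conj_commute)
  have "emeasure (env_path_law (shift (step k) \<omega>)) {Y \<in> space env_paths. case_nat \<omega> Y \<in> D} =
      emeasure (walk_law \<E> (shift (step k) \<omega>)) {X. case_nat 0 (\<lambda>n. step k + X n) \<in> ?D}" for k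
  proof -
    have "(\<lambda>n. shift (case_nat 0 (\<lambda>n. step k + X n) n) \<omega>) = case_nat \<omega> (\<lambda>n. shift (X n) (shift (step k) \<omega>))"
      for X by (auto simp: fun_eq_iff shift_add[symmetric] split: nat.split)
    moreover have "(\<lambda>n. shift (X n) (shift (step k) \<omega>)) \<in> space env_paths" for X
      using \<omega> by (auto simp: space_PiM)
    ultimately show ?thesis
      using \<omega> unfolding env_path_law_def
      by (subst emeasure_distr[OF measurable_env_path sets]) (auto simp: space_walk_law vimage_def)
  qed
  moreover have "emeasure (env_path_law \<omega>) D = emeasure (walk_law \<E> \<omega>) ?D"
    unfolding env_path_law_def using \<omega>
    by (subst emeasure_distr[OF measurable_env_path D]) (auto simp: space_walk_law vimage_def)
  ultimately show ?thesis
    using walk_law_first_step[OF \<omega> D'] by simp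
qed

text \<open>The constraint runs over \<open>i < n\<close>: length 0 gives the whole path space, and
  length \<open>Suc n\<close> splits into a condition on the present state and a cylinder of length
  \<open>n\<close>, which suits induction by first steps.\<close>

definition env_cylinder :: "(nat \<Rightarrow> 'd environment set) \<Rightarrow> nat \<Rightarrow> (nat \<Rightarrow> 'd environment) set" where
  "env_cylinder B n = {Y \<in> space env_paths. \<forall>i<n. Y i \<in> B i}"

lemma env_cylinder_sets:
  assumes "\<And>i. B i \<in> sets env_borel"
  shows "env_cylinder B n \<in> sets env_paths"
  using assms unfolding env_cylinder_def by measurable

lemma env_cylinder_Suc:
  assumes "\<omega> \<in> space env_borel"
  shows "{Y \<in> space env_paths. case_nat \<omega> Y \<in> env_cylinder B (Suc n)} =
    (if \<omega> \<in> B 0 then env_cylinder (\<lambda>i. B (Suc i)) n else {})"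
  using assms by (auto simp: env_cylinder_def space_PiM less_Suc_eq_0_disj PiE_iff split: nat.splits)

text \<open>Padding with the whole space brings both cylinders to the length
  \<open>max n m\<close>.\<close>

lemma env_cylinder_Int:
  "env_cylinder B n \<inter> env_cylinder B' m =
    env_cylinder (\<lambda>i. (if i < n then B i else space env_borel) \<inter> (if i < m then B' i else space env_borel)) (max n m)"
  by (auto simp: env_cylinder_def space_PiM PiE_iff less_max_iff_disj split: if_splits)

lemma Int_stable_env_cylinder:
  "Int_stable {env_cylinder B n |B n. \<forall>i. B i \<in> sets env_borel}"
proof (rule Int_stableI, clarify)
  fix B B' :: "nat \<Rightarrow> 'd environment set" and n m
  assume "\<forall>i. B i \<in> sets env_borel" "\<forall>i. B' i \<in> sets env_borel"
  then show "\<exists>C l. env_cylinder B n \<inter> env_cylinder B' m = env_cylinder C l \<and> (\<forall>i. C i \<in> sets env_borel)"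
    unfolding env_cylinder_Int by (intro exI conjI refl allI) auto
qed

lemma sets_env_paths:
  "sets env_paths = sigma_sets (space env_paths) {env_cylinder B n |B n. \<forall>i. B i \<in> sets env_borel}"
  (is "_ = sigma_sets _ ?G")
proof (rule antisym)
  have "{Y \<in> space env_paths. Y i \<in> A} \<in> sigma_sets (space env_paths) ?G" if "A \<in> sets env_borel" for i A
  proof -
    have "{Y \<in> space env_paths. Y i \<in> A} = env_cylinder (\<lambda>j. if j = i then A else space env_borel) (Suc i)"
      by (auto simp: env_cylinder_def space_PiM)
    then show ?thesis
      using that by (intro sigma_sets.Basic) (auto intro!: exI)
  qed
  then show "sets env_paths \<subseteq> sigma_sets (space env_paths) ?G"
    unfolding sets_PiM_single space_PiM[symmetric] by (intro sigma_sets_mono) blast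
  show "sigma_sets (space env_paths) ?G \<subseteq> sets env_paths"
    by (rule sets.sigma_sets_subset) (auto intro: env_cylinder_sets)
qed

text \<open>On cylinders the first-step formula gives measurability by induction on the length. This
  is what makes the \<open>bind\<close> in \<open>env_process_law\<close> a mixture of the laws
  \<open>env_path_law \<omega>\<close>.\<close>

lemma measurable_env_path_law: "env_path_law \<in> measurable env_borel (subprob_algebra env_paths)"
proof (rule measurable_subprob_algebra_generated[OF sets_env_paths Int_stable_env_cylinder])
  have "(\<lambda>\<omega>. emeasure (env_path_law \<omega>) (env_cylinder B n)) \<in> borel_measurable env_borel"
    if "\<And>i. B i \<in> sets env_borel" for B n
    using that
  proof (induction n arbitrary: B)
    case 0
    have "emeasure (env_path_law \<omega>) (env_cylinder B 0) = 1" if "\<omega> \<in> space env_borel" for \<omega>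
      using prob_space.emeasure_space_1[OF prob_space_env_path_law[OF that]]
      by (simp add: env_cylinder_def env_path_law_def)
    then show ?case by (subst measurable_cong) auto
  next
    case (Suc n)
    have "emeasure (env_path_law \<omega>) (env_cylinder B (Suc n)) = indicator (B 0) \<omega> *
        (\<Sum>k\<in>UNIV. ennreal (\<E> (\<omega> 0) k) * emeasure (env_path_law (shift (step k) \<omega>)) (env_cylinder (\<lambda>i. B (Suc i)) n))"
      if "\<omega> \<in> space env_borel" for \<omega>
      using that by (subst env_path_law_first_step) (auto intro!: env_cylinder_sets Suc.prems simp: env_cylinder_Suc)
    moreover have "(\<lambda>\<omega>. emeasure (env_path_law (shift (step k) \<omega>)) (env_cylinder (\<lambda>i. B (Suc i)) n))
        \<in> borel_measurable env_borel" for k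
      by (intro measurable_compose[OF measurable_shift Suc.IH] Suc.prems)
    ultimately show ?case
      using Suc.prems[of 0] by (subst measurable_cong) auto
  qed
  then show "(\<lambda>\<omega>. emeasure (env_path_law \<omega>) A) \<in> borel_measurable env_borel"
    if "A \<in> {env_cylinder B n |B n. \<forall>i. B i \<in> sets env_borel}" for A
    using that by auto
  have "emeasure (env_path_law \<omega>) (space env_paths) = 1" if "\<omega> \<in> space env_borel" for \<omega>
    using prob_space.emeasure_space_1[OF prob_space_env_path_law[OF that]] by (simp add: env_path_law_def)
  then show "(\<lambda>\<omega>. emeasure (env_path_law \<omega>) (space env_paths)) \<in> borel_measurable env_borel"
    by (subst measurable_cong) auto
qed (auto simp: env_cylinder_def prob_space_env_path_law prob_space_imp_subprob_space)

end

section \<open>Stationarity, equivalence and ergodicity\<close>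

text \<open>The steps generate the lattice: one coordinate after another is reached by a run of
  forward or backward steps.\<close>

lemma lattice_induct [case_names zero step]:
  fixes x :: "int ^ 'd::finite"
  assumes zero: "P 0" and step: "\<And>x k. P x \<Longrightarrow> P (x + step k)"
  shows "P x"
proof -
  have axis: "P (y + axis i n)" if y: "P y" for y :: "int ^ 'd" and i n
  proof (induction n rule: int_induct[of _ 0])
    case base
    have "axis i 0 = (0 :: int ^ 'd)" by (simp add: axis_def vec_eq_iff)
    with y show ?case by (metis add.right_neutral)
  next
    case (step1 n)
    have "y + axis i (n + 1) = (y + axis i n) + step (Fwd i)" by (simp add: axis_def vec_eq_iff)
    with step[OF step1(2)] show ?case by metis
  next
    case (step2 n)
    have "y + axis i (n - 1) = (y + axis i n) + step (Bwd i)" by (simp add: axis_def vec_eq_iff)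
    with step[OF step2(2)] show ?case by metis
  qed
  have "P (\<chi> i. if i \<in> S then x $ i else 0)" if "finite S" for S
    using that
  proof induction
    case empty
    have "(\<chi> i. if i \<in> {} then x $ i else 0) = 0" by (simp add: vec_eq_iff)
    with zero show ?case by metis
  next
    case (insert j S)
    have "(\<chi> i. if i \<in> insert j S then x $ i else 0) = (\<chi> i. if i \<in> S then x $ i else 0) + axis j (x $ j)"
      using insert(2) by (auto simp: axis_def vec_eq_iff)
    with axis[OF insert(3)] show ?case by metis
  qed
  from this[of UNIV] show ?thesis by simp
qed

lemma stationary_under_shiftD:
  assumes "stationary_under \<mu> (range shift)"
  shows "shift x \<in> measurable \<mu> \<mu>" "distr \<mu> \<mu> (shift x) = \<mu>"
  using assms by (auto simp: stationary_under_def)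

text \<open>Stationarity moves the exceptional null set along each shift, and the lattice is
  countable.\<close>

lemma AE_all_shifts:
  assumes "stationary_under \<mu> (range shift)" and "AE \<omega> in \<mu>. P \<omega>"
  shows "AE \<omega> in \<mu>. \<forall>x. P (shift x \<omega>)"
  unfolding AE_all_countable
proof
  fix x
  from assms(2) have "AE \<omega> in distr \<mu> \<mu> (shift x). P \<omega>"
    by (simp only: stationary_under_shiftD[OF assms(1)])
  then show "AE \<omega> in \<mu>. P (shift x \<omega>)"
    by (rule AE_distrD[OF stationary_under_shiftD(1)[OF assms(1)]])
qed

lemma ennreal_add_eq_right_imp_0:
  fixes a b :: ennreal
  assumes "a + b = b" "b \<noteq> \<top>"
  shows "a = 0"
  using assms ennreal_add_left_cancel[of b a 0] by (simp add: add.commute)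

context environment_function
begin

section \<open>Invariant measures of the environment kernel\<close>

definition env_invariant :: "'d environment measure \<Rightarrow> bool" where
  "env_invariant \<nu> \<longleftrightarrow> (\<forall>A\<in>sets env_borel.
     (\<integral>\<^sup>+\<omega>. (\<Sum>k\<in>UNIV. ennreal (\<E> (\<omega> 0) k) * indicator A (shift (step k) \<omega>)) \<partial>\<nu>) = emeasure \<nu> A)"

text \<open>Invariance is defined on indicators and extends by the standard induction, since the
  finite sum over the steps commutes with monotone limits.\<close>

lemma env_invariant_nn_integral:
  assumes inv: "env_invariant \<nu>" and sets[measurable_cong]: "sets \<nu> = sets env_borel"
    and f: "f \<in> borel_measurable env_borel"
  shows "(\<integral>\<^sup>+\<omega>. (\<Sum>k\<in>UNIV. ennreal (\<E> (\<omega> 0) k) * f (shift (step k) \<omega>)) \<partial>\<nu>) = (\<integral>\<^sup>+\<omega>. f \<omega> \<partial>\<nu>)"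
  using f
proof induction
  case (cong f g)
  have "(\<Sum>k\<in>UNIV. ennreal (\<E> (\<omega> 0) k) * f (shift (step k) \<omega>)) =
      (\<Sum>k\<in>UNIV. ennreal (\<E> (\<omega> 0) k) * g (shift (step k) \<omega>))" if "\<omega> \<in> space \<nu>" for \<omega>
    using that cong(3) sets_eq_imp_space_eq[OF sets] by simp
  moreover have "(\<integral>\<^sup>+\<omega>. f \<omega> \<partial>\<nu>) = (\<integral>\<^sup>+\<omega>. g \<omega> \<partial>\<nu>)"
    using cong(3) sets_eq_imp_space_eq[OF sets] by (intro nn_integral_cong) auto
  ultimately show ?case using cong(4) by (simp cong: nn_integral_cong_simp)
next
  case (set A)
  then show ?case using inv by (simp add: env_invariant_def sets)
next
  case (mult u c)
  note [measurable] = mult(2)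
  have "(\<integral>\<^sup>+\<omega>. (\<Sum>k\<in>UNIV. ennreal (\<E> (\<omega> 0) k) * (c * u (shift (step k) \<omega>))) \<partial>\<nu>) =
      (\<integral>\<^sup>+\<omega>. c * (\<Sum>k\<in>UNIV. ennreal (\<E> (\<omega> 0) k) * u (shift (step k) \<omega>)) \<partial>\<nu>)"
    by (simp add: sum_distrib_left mult.left_commute)
  also have "\<dots> = c * (\<integral>\<^sup>+\<omega>. (\<Sum>k\<in>UNIV. ennreal (\<E> (\<omega> 0) k) * u (shift (step k) \<omega>)) \<partial>\<nu>)"
    by (rule nn_integral_cmult) measurable
  also have "\<dots> = (\<integral>\<^sup>+\<omega>. c * u \<omega> \<partial>\<nu>)"
    unfolding mult(4) by (rule nn_integral_cmult[symmetric]) measurable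
  finally show ?case .
next
  case (add u v)
  note [measurable] = add.hyps(1,3)
  have "(\<integral>\<^sup>+\<omega>. (\<Sum>k\<in>UNIV. ennreal (\<E> (\<omega> 0) k) * (v (shift (step k) \<omega>) + u (shift (step k) \<omega>))) \<partial>\<nu>) =
      (\<integral>\<^sup>+\<omega>. (\<Sum>k\<in>UNIV. ennreal (\<E> (\<omega> 0) k) * v (shift (step k) \<omega>))
         + (\<Sum>k\<in>UNIV. ennreal (\<E> (\<omega> 0) k) * u (shift (step k) \<omega>)) \<partial>\<nu>)"
    by (simp add: distrib_left sum.distrib)
  also have "\<dots> = (\<integral>\<^sup>+\<omega>. v \<omega> \<partial>\<nu>) + (\<integral>\<^sup>+\<omega>. u \<omega> \<partial>\<nu>)"
    unfolding add.IH[symmetric] by (rule nn_integral_add) measurable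
  also have "\<dots> = (\<integral>\<^sup>+\<omega>. v \<omega> + u \<omega> \<partial>\<nu>)"
    by (rule nn_integral_add[symmetric]) measurable
  finally show ?case .
next
  case (seq U)
  note [measurable] = seq(1)
  let ?s = "\<lambda>i \<omega>. \<Sum>k\<in>UNIV. ennreal (\<E> (\<omega> 0) k) * U i (shift (step k) \<omega>)"
  have inc: "incseq (\<lambda>i. ennreal (\<E> (\<omega> 0) k) * U i (shift (step k) \<omega>))" for \<omega> k
    using seq(3) by (auto simp: incseq_def le_fun_def intro!: mult_left_mono)
  have "(\<integral>\<^sup>+\<omega>. (\<Sum>k\<in>UNIV. ennreal (\<E> (\<omega> 0) k) * (SUP i. U i) (shift (step k) \<omega>)) \<partial>\<nu>) =
      (\<integral>\<^sup>+\<omega>. (SUP i. ?s i \<omega>) \<partial>\<nu>)"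
  proof (rule nn_integral_cong)
    show "(\<Sum>k\<in>UNIV. ennreal (\<E> (\<omega> 0) k) * (SUP i. U i) (shift (step k) \<omega>)) = (SUP i. ?s i \<omega>)" for \<omega>
      by (subst ennreal_SUP_sum) (simp_all add: inc image_comp SUP_mult_left_ennreal)
  qed
  also have "\<dots> = (SUP i. \<integral>\<^sup>+\<omega>. ?s i \<omega> \<partial>\<nu>)"
  proof (rule nn_integral_monotone_convergence_SUP)
    show "incseq ?s"
      using inc by (auto simp: incseq_def le_fun_def intro!: sum_mono)
    show "?s i \<in> borel_measurable \<nu>" for i
      by measurable
  qed
  also have "\<dots> = (SUP i. \<integral>\<^sup>+\<omega>. U i \<omega> \<partial>\<nu>)"
    by (simp only: seq.IH)
  also have "\<dots> = (\<integral>\<^sup>+\<omega>. (SUP i. U i \<omega>) \<partial>\<nu>)"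
    by (rule nn_integral_monotone_convergence_SUP[symmetric, OF seq(3)]) measurable
  finally show ?case by (simp add: SUP_apply image_comp)
qed

lemma env_process_law_eq: "env_process_law \<E> \<nu> = \<nu> \<bind> env_path_law"
  by (simp add: env_process_law_def env_path_law_def[abs_def])

lemma measurable_env_path_law' [measurable]:
  "D \<in> sets env_paths \<Longrightarrow> (\<lambda>\<omega>. emeasure (env_path_law \<omega>) D) \<in> borel_measurable env_borel"
  using measurable_env_path_law by (rule measurable_emeasure_kernel)

lemma env_process_law:
  assumes \<nu>: "prob_space \<nu>" "sets \<nu> = sets env_borel"
  shows "sets (env_process_law \<E> \<nu>) = sets env_paths"
    and "D \<in> sets env_paths \<Longrightarrow> emeasure (env_process_law \<E> \<nu>) D = (\<integral>\<^sup>+\<omega>. emeasure (env_path_law \<omega>) D \<partial>\<nu>)"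
proof -
  have m: "env_path_law \<in> measurable \<nu> (subprob_algebra env_paths)"
    unfolding measurable_cong_sets[OF \<nu>(2) refl] by (rule measurable_env_path_law)
  have ne: "space \<nu> \<noteq> {}" by (rule prob_space.not_empty[OF \<nu>(1)])
  show "sets (env_process_law \<E> \<nu>) = sets env_paths"
    unfolding env_process_law_eq by (rule sets_bind[OF _ ne]) simp
  show "D \<in> sets env_paths \<Longrightarrow> emeasure (env_process_law \<E> \<nu>) D = (\<integral>\<^sup>+\<omega>. emeasure (env_path_law \<omega>) D \<partial>\<nu>)"
    unfolding env_process_law_eq by (rule emeasure_bind[OF ne m])
qed

lemma measurable_time_shift: "time_shift \<in> measurable env_paths env_paths"
  unfolding time_shift_def
  by (intro measurable_abs_UNIV measurable_component_singleton) simp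

lemma time_shift_case_nat: "time_shift (case_nat \<omega> Y) = Y"
  by (simp add: time_shift_def)

lemma case_nat_in_env_paths:
  "\<omega> \<in> space env_borel \<Longrightarrow> case_nat \<omega> Y \<in> space env_paths \<longleftrightarrow> Y \<in> space env_paths"
proof -
  assume \<omega>: "\<omega> \<in> space env_borel"
  have "(\<forall>n. case_nat \<omega> Y n \<in> space env_borel) \<longleftrightarrow> (\<forall>n. Y n \<in> space env_borel)"
    using \<omega> by (auto split: nat.split dest: spec[of _ "Suc _"])
  then show ?thesis by (simp add: space_PiM PiE_iff)
qed

text \<open>Given the start \<omega>, the time-shifted event has as probability the one-step mean of
  P_\<omega>(D); invariance of \<nu>, applied to this function of \<omega>, removes the
  mean.\<close>

lemma stationary_env_process_law:
  assumes \<nu>: "prob_space \<nu>" "sets \<nu> = sets env_borel" and inv: "env_invariant \<nu>"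
  shows "stationary_under (env_process_law \<E> \<nu>) {time_shift}"
proof -
  let ?M = "env_process_law \<E> \<nu>"
  note sets = env_process_law(1)[OF \<nu>]
  have space: "space \<nu> = space env_borel" by (rule sets_eq_imp_space_eq[OF \<nu>(2)])
  have m: "time_shift \<in> measurable ?M ?M"
    unfolding measurable_cong_sets[OF sets sets] by (rule measurable_time_shift)
  moreover have "distr ?M ?M time_shift = ?M"
  proof (rule measure_eqI)
    fix D assume "D \<in> sets (distr ?M ?M time_shift)"
    then have D: "D \<in> sets env_paths" by (simp add: sets)
    let ?D = "time_shift -` D \<inter> space env_paths"
    have D': "?D \<in> sets env_paths" by (rule measurable_sets[OF measurable_time_shift D])
    have *: "{Y \<in> space env_paths. case_nat \<omega> Y \<in> ?D} = D" if "\<omega> \<in> space env_borel" for \<omega>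
      using that sets.sets_into_space[OF D] by (auto simp: time_shift_case_nat case_nat_in_env_paths)
    have "emeasure (distr ?M ?M time_shift) D = emeasure ?M ?D"
      using D by (subst emeasure_distr[OF m]) (simp_all add: sets sets_eq_imp_space_eq[OF sets])
    also have "\<dots> = (\<integral>\<^sup>+\<omega>. emeasure (env_path_law \<omega>) ?D \<partial>\<nu>)"
      by (rule env_process_law(2)[OF \<nu> D'])
    also have "\<dots> = (\<integral>\<^sup>+\<omega>. (\<Sum>k\<in>UNIV. ennreal (\<E> (\<omega> 0) k) * emeasure (env_path_law (shift (step k) \<omega>)) D) \<partial>\<nu>)"
    proof (rule nn_integral_cong)
      show "emeasure (env_path_law \<omega>) ?D =
          (\<Sum>k\<in>UNIV. ennreal (\<E> (\<omega> 0) k) * emeasure (env_path_law (shift (step k) \<omega>)) D)"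
        if "\<omega> \<in> space \<nu>" for \<omega>
        using that unfolding space by (simp only: env_path_law_first_step[OF _ D'] *)
    qed
    also have "\<dots> = (\<integral>\<^sup>+\<omega>. emeasure (env_path_law \<omega>) D \<partial>\<nu>)"
      by (rule env_invariant_nn_integral[OF inv \<nu>(2) measurable_env_path_law'[OF D]])
    also have "\<dots> = emeasure ?M D"
      by (rule env_process_law(2)[OF \<nu> D, symmetric])
    finally show "emeasure (distr ?M ?M time_shift) D = emeasure ?M D" .
  qed simp
  ultimately show ?thesis by (simp add: stationary_under_def)
qed

text \<open>\<open>absolutely_continuous \<mu> \<nu>\<close> says that \<mu>-null sets are
  \<nu>-null. For the converse, a \<nu>-null set is enlarged to the union of its translates, which
  is still \<nu>-null and on which ergodicity of \<mu> leaves only the measure 0.\<close>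

lemma env_invariant_dominates:
  assumes \<mu>: "prob_space \<mu>" "sets \<mu> = sets env_borel"
    and erg: "stationary_under \<mu> (range shift)" "ergodic_under \<mu> (range shift)"
    and pos: "AE \<omega> in \<mu>. \<forall>k. 0 < \<E> (\<omega> 0) k"
    and \<nu>: "prob_space \<nu>" "sets \<nu> = sets env_borel" and inv: "env_invariant \<nu>"
    and ac: "absolutely_continuous \<mu> \<nu>"
  shows "absolutely_continuous \<nu> \<mu>"
proof -
  interpret mu: prob_space \<mu> by (rule \<mu>(1))
  note [measurable_cong] = \<nu>(2)
  have space: "space \<nu> = space env_borel" "space \<mu> = space env_borel"
    by (rule sets_eq_imp_space_eq[OF \<nu>(2)], rule sets_eq_imp_space_eq[OF \<mu>(2)])
  have pos\<nu>: "AE \<omega> in \<nu>. \<forall>k. 0 < \<E> (\<omega> 0) k"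
    using absolutely_continuous_AE[OF _ ac pos] \<mu>(2) \<nu>(2) by simp
  \<comment> \<open>Invariance writes the mass of \<open>A\<close> as an integral of nonnegative
    terms with almost surely positive weights, so each term vanishes almost everywhere.\<close>
  have step_null: "AE \<omega> in \<nu>. shift (step k) \<omega> \<notin> A" if A: "A \<in> sets env_borel" "AE \<omega> in \<nu>. \<omega> \<notin> A" for A k
  proof -
    note [measurable] = A(1)
    have "(\<integral>\<^sup>+\<omega>. (\<Sum>k\<in>UNIV. ennreal (\<E> (\<omega> 0) k) * indicator A (shift (step k) \<omega>)) \<partial>\<nu>) = 0"
      using inv A by (simp add: env_invariant_def AE_iff_measurable[of A \<nu>] \<nu>(2) AE_not_in)
        (auto simp: AE_iff_null_sets[symmetric] \<nu>(2) null_sets_def dest: AE_iff_null_sets)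
    then have "AE \<omega> in \<nu>. (\<Sum>k\<in>UNIV. ennreal (\<E> (\<omega> 0) k) * indicator A (shift (step k) \<omega>)) = 0"
      by (subst (asm) nn_integral_0_iff_AE) measurable
    with pos\<nu> show ?thesis
    proof eventually_elim
      case (elim \<omega>)
      then have "ennreal (\<E> (\<omega> 0) k) * indicator A (shift (step k) \<omega>) = 0"
        by (subst (asm) sum_nonneg_eq_0_iff) auto
      with elim(1) show ?case
        by (auto simp: indicator_def ennreal_eq_0_iff not_le[symmetric] split: if_splits)
    qed
  qed
  have "A \<in> null_sets \<mu>" if A: "A \<in> null_sets \<nu>" for A
  proof -
    have A_sets: "A \<in> sets env_borel" using A \<nu>(2) by (auto simp: null_sets_def)
    have shift_sets: "shift x -` A \<inter> space env_borel \<in> sets env_borel" for x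
      using A_sets by measurable
    have "AE \<omega> in \<nu>. shift x \<omega> \<notin> A" for x
    proof (induction x rule: lattice_induct)
      case zero
      show ?case using AE_not_in[OF A] by simp
    next
      case (step x k)
      have "AE \<omega> in \<nu>. \<omega> \<notin> shift x -` A \<inter> space env_borel"
        using step by eventually_elim simp
      from step_null[OF shift_sets this, of k]
      have "AE \<omega> in \<nu>. shift x (shift (step k) \<omega>) \<notin> A"
        using AE_space by eventually_elim (simp add: space)
      then show ?case by (simp add: shift_add[symmetric] add.commute)
    qed
    then have all: "AE \<omega> in \<nu>. \<forall>x. shift x \<omega> \<notin> A"
      by (simp add: AE_all_countable)
    define U where "U = (\<Union>x. shift x -` A \<inter> space env_borel)"
    have U: "U \<in> sets \<mu>" unfolding U_def \<mu>(2) using shift_sets by blast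
    have "shift y -` U \<inter> space \<mu> = U" for y
    proof -
      have "shift y \<omega> \<in> U \<longleftrightarrow> \<omega> \<in> U" if "\<omega> \<in> space env_borel" for \<omega>
      proof
        assume "shift y \<omega> \<in> U"
        then obtain x where "shift x (shift y \<omega>) \<in> A" by (auto simp: U_def)
        then have "shift (y + x) \<omega> \<in> A" by (simp add: shift_add)
        then show "\<omega> \<in> U" using that by (auto simp: U_def)
      next
        assume "\<omega> \<in> U"
        then obtain x where "shift x \<omega> \<in> A" by (auto simp: U_def)
        then have "shift (x - y) (shift y \<omega>) \<in> A" by (simp add: shift_add[symmetric])
        then show "shift y \<omega> \<in> U" using that by (auto simp: U_def)
      qed
      moreover have "U \<subseteq> space env_borel" by (auto simp: U_def)
      ultimately show ?thesis by (auto simp: space)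
    qed
    then have "measure \<mu> U \<in> {0, 1}"
      using erg(2) U unfolding ergodic_under_def by auto
    \<comment> \<open>Full \<mu>-measure of \<open>U\<close> would pass to \<nu> by absolute
      continuity, contradicting that \<open>U\<close> is \<nu>-null.\<close>
    moreover have "measure \<mu> U \<noteq> 1"
    proof
      assume "measure \<mu> U = 1"
      then have "AE \<omega> in \<mu>. \<omega> \<in> U" by (subst prob_space.AE_in_set_eq_1[OF \<mu>(1) U])
      then have "AE \<omega> in \<nu>. \<omega> \<in> U"
        using absolutely_continuous_AE[OF _ ac] \<mu>(2) \<nu>(2) by simp
      with all have "AE \<omega> in \<nu>. False" by eventually_elim (auto simp: U_def)
      then show False using prob_space.AE_False[OF \<nu>(1)] by simp
    qed
    ultimately have "U \<in> null_sets \<mu>"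
      using U by (auto simp: null_sets_def mu.emeasure_eq_measure)
    moreover have "A \<subseteq> U"
      using sets.sets_into_space[OF A_sets] by (auto simp: U_def intro!: exI[of _ 0])
    ultimately show ?thesis using A_sets \<mu>(2) by (auto intro: null_sets_subset)
  qed
  then show ?thesis by (auto simp: absolutely_continuous_def)
qed

text \<open>After finitely many steps the walk is at another point of the orbit, from which the
  invariant event still has probability \<open>c\<close>; it is therefore independent of every
  cylinder, and hence of every event.\<close>

lemma env_path_law_Int_invariant:
  assumes A: "A \<in> sets env_paths" "time_shift -` A \<inter> space env_paths = A"
    and \<omega>: "\<omega> \<in> space env_borel"
    and const: "\<And>x. emeasure (env_path_law (shift x \<omega>)) A = c"
    and D: "D \<in> sets env_paths"
  shows "emeasure (env_path_law \<omega>) (A \<inter> D) = c * emeasure (env_path_law \<omega>) D"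
proof -
  have A_iff: "case_nat \<omega> Y \<in> A \<longleftrightarrow> Y \<in> A" if "\<omega> \<in> space env_borel" for \<omega> Y
    using A(2) sets.sets_into_space[OF A(1)] case_nat_in_env_paths[OF that, of Y] time_shift_case_nat[of \<omega> Y]
    by (metis (no_types, lifting) IntE IntI subsetD vimageE vimageI)
  \<comment> \<open>The environment is generalized because the induction passes to
    \<open>shift (step k) \<omega>\<close>; its translates are translates of
    \<open>\<omega>\<close>, so the hypothesis on \<open>c\<close> survives.\<close>
  have cyl: "emeasure (env_path_law \<omega>) (A \<inter> env_cylinder B n) = c * emeasure (env_path_law \<omega>) (env_cylinder B n)"
    if "\<And>i. B i \<in> sets env_borel" "\<omega> \<in> space env_borel"
      "\<And>x. emeasure (env_path_law (shift x \<omega>)) A = c" for B n \<omega>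
    using that
  proof (induction n arbitrary: B \<omega>)
    case 0
    have "A \<inter> env_cylinder B 0 = A" and "env_cylinder B 0 = space (env_path_law \<omega>)"
      using sets.sets_into_space[OF A(1)] by (auto simp: env_cylinder_def env_path_law_def)
    then show ?case
      using prob_space.emeasure_space_1[OF prob_space_env_path_law[OF 0(2)]] 0(3)[of 0] by simp
  next
    case (Suc n)
    have cm: "env_cylinder B (Suc n) \<in> sets env_paths"
      using Suc.prems(1) by (rule env_cylinder_sets)
    have "{Y \<in> space env_paths. case_nat \<omega> Y \<in> A \<inter> env_cylinder B (Suc n)} =
        (if \<omega> \<in> B 0 then A \<inter> env_cylinder (\<lambda>i. B (Suc i)) n else {})"
      using env_cylinder_Suc[OF Suc.prems(2), of B n] A_iff[OF Suc.prems(2)] sets.sets_into_space[OF A(1)]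
      by (auto split: if_splits)
    moreover have "emeasure (env_path_law (shift (step k) \<omega>)) (A \<inter> env_cylinder (\<lambda>i. B (Suc i)) n) =
        c * emeasure (env_path_law (shift (step k) \<omega>)) (env_cylinder (\<lambda>i. B (Suc i)) n)" for k
      using Suc.prems by (intro Suc.IH) (simp_all add: shift_add[symmetric])
    ultimately show ?case
      using A(1) cm by (simp add: env_path_law_first_step[OF Suc.prems(2)] env_cylinder_Suc[OF Suc.prems(2)]
          sum_distrib_left mult.left_commute)
  qed
  let ?P = "env_path_law \<omega>"
  interpret P: prob_space ?P by (rule prob_space_env_path_law[OF \<omega>])
  \<comment> \<open>As functions of \<open>D\<close>, the two sides are the restriction of
    \<open>?P\<close> to \<open>A\<close> and a multiple of \<open>?P\<close>; agreement on the
    generator suffices.\<close>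
  have "density ?P (indicator A) = scale_measure c ?P"
  proof (rule measure_eqI_generator_eq_countable[OF Int_stable_env_cylinder _ _ _ _ _ _ _, where A="{space env_paths}"])
    show "{env_cylinder B n |B n. \<forall>i. B i \<in> sets env_borel} \<subseteq> Pow (space env_paths)"
      by (auto simp: env_cylinder_def)
    show "emeasure (density ?P (indicator A)) X = emeasure (scale_measure c ?P) X"
      if "X \<in> {env_cylinder B n |B n. \<forall>i. B i \<in> sets env_borel}" for X
    proof -
      from that obtain B n where X: "X = env_cylinder B n" "\<And>i. B i \<in> sets env_borel" by auto
      then have "X \<in> sets env_paths" by (simp add: env_cylinder_sets)
      then show ?thesis
        using cyl[OF X(2) \<omega> const] A(1) by (simp add: emeasure_restricted X(1))
    qed
    show "{space env_paths} \<subseteq> {env_cylinder B n |B n. \<forall>i. B i \<in> sets env_borel}"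
      by (auto intro!: exI[of _ "\<lambda>_. {}"] exI[of _ 0] simp: env_cylinder_def)
    show "emeasure (density ?P (indicator A)) X \<noteq> \<infinity>" if "X \<in> {space env_paths}" for X
      using that A(1) by (simp add: emeasure_restricted)
  qed (simp_all add: sets_env_paths)
  then have "emeasure (density ?P (indicator A)) D = emeasure (scale_measure c ?P) D" by simp
  then show ?thesis using A(1) D by (simp add: emeasure_restricted)
qed

text \<open>Prepending a state does not affect membership in an invariant event, so the first-step
  formula becomes harmonicity.\<close>

lemma env_path_law_invariant_harmonic:
  assumes A: "A \<in> sets env_paths" "time_shift -` A \<inter> space env_paths = A" and \<omega>: "\<omega> \<in> space env_borel"
  shows "measure (env_path_law \<omega>) A = (\<Sum>k\<in>UNIV. \<E> (\<omega> 0) k * measure (env_path_law (shift (step k) \<omega>)) A)"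
proof -
  have "{Y \<in> space env_paths. case_nat \<omega> Y \<in> A} = A"
    using A(2) sets.sets_into_space[OF A(1)] case_nat_in_env_paths[OF \<omega>] time_shift_case_nat[of \<omega>]
    by (metis (no_types, lifting) Collect_cong Collect_mem_eq IntE IntI subsetD vimageE vimageI)
  then have "emeasure (env_path_law \<omega>) A =
      (\<Sum>k\<in>UNIV. ennreal (\<E> (\<omega> 0) k) * emeasure (env_path_law (shift (step k) \<omega>)) A)"
    using env_path_law_first_step[OF \<omega> A(1)] by simp
  moreover have "emeasure (env_path_law \<omega>') A = ennreal (measure (env_path_law \<omega>') A)"
    if "\<omega>' \<in> space env_borel" for \<omega>'
  proof -
    interpret prob_space "env_path_law \<omega>'" using that by (rule prob_space_env_path_law)
    show ?thesis by (rule emeasure_eq_measure)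
  qed
  ultimately have "ennreal (measure (env_path_law \<omega>) A) =
      ennreal (\<Sum>k\<in>UNIV. \<E> (\<omega> 0) k * measure (env_path_law (shift (step k) \<omega>)) A)"
    using \<omega> by (simp add: prob_nonneg sum_ennreal[symmetric] ennreal_mult)
  then show ?thesis
    using \<omega> by (simp add: prob_nonneg sum_nonneg)
qed

lemma ergodic_env_process_law:
  assumes \<mu>: "prob_space \<mu>" "sets \<mu> = sets env_borel"
    and erg: "stationary_under \<mu> (range shift)" "ergodic_under \<mu> (range shift)"
    and pos: "AE \<omega> in \<mu>. \<forall>k. 0 < \<E> (\<omega> 0) k"
    and \<nu>: "prob_space \<nu>" "sets \<nu> = sets env_borel" and inv: "env_invariant \<nu>"
    and ac: "absolutely_continuous \<mu> \<nu>"
  shows "ergodic_under (env_process_law \<E> \<nu>) {time_shift}"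
  unfolding ergodic_under_def
proof (intro ballI impI)
  let ?M = "env_process_law \<E> \<nu>"
  interpret mu: prob_space \<mu> by (rule \<mu>(1))
  interpret nu: prob_space \<nu> by (rule \<nu>(1))
  have space: "space \<nu> = space env_borel" "space \<mu> = space env_borel"
    by (rule sets_eq_imp_space_eq[OF \<nu>(2)], rule sets_eq_imp_space_eq[OF \<mu>(2)])
  note sets_M = env_process_law(1)[OF \<nu>]
  fix A assume "A \<in> sets ?M" "\<forall>T\<in>{time_shift}. T -` A \<inter> space ?M = A"
  then have A: "A \<in> sets env_paths" "time_shift -` A \<inter> space env_paths = A"
    by (simp_all add: sets_M sets_eq_imp_space_eq[OF sets_M])
  define h where "h \<omega> = measure (env_path_law \<omega>) A" for \<omega>
  have h_emeasure: "emeasure (env_path_law \<omega>) A = ennreal (h \<omega>)" if "\<omega> \<in> space env_borel" for \<omega>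
  proof -
    interpret prob_space "env_path_law \<omega>" using that by (rule prob_space_env_path_law)
    show ?thesis by (simp add: h_def emeasure_eq_measure)
  qed
  have h_meas [measurable]: "h \<in> borel_measurable env_borel"
    unfolding h_def[abs_def] measure_def using measurable_env_path_law'[OF A(1)] by measurable
  have h_nonneg: "0 \<le> h \<omega>" for \<omega> by (simp add: h_def)
  have h_le_1: "h \<omega> \<le> 1" if "\<omega> \<in> space env_borel" for \<omega>
    unfolding h_def by (intro prob_space.prob_le_1 prob_space_env_path_law that)
  \<comment> \<open>The first sum is the conditional variance of one step of \<open>h\<close>,
    because harmonicity makes \<open>h \<omega>\<close> the conditional mean.\<close>
  have variance: "(\<Sum>k\<in>UNIV. \<E> (\<omega> 0) k * (h (shift (step k) \<omega>) - h \<omega>)\<^sup>2) + (h \<omega>)\<^sup>2 =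
      (\<Sum>k\<in>UNIV. \<E> (\<omega> 0) k * (h (shift (step k) \<omega>))\<^sup>2)" if \<omega>: "\<omega> \<in> space env_borel" for \<omega>
  proof -
    have "(\<Sum>k\<in>UNIV. \<E> (\<omega> 0) k * (h (shift (step k) \<omega>) - h \<omega>)\<^sup>2) =
        (\<Sum>k\<in>UNIV. \<E> (\<omega> 0) k * (h (shift (step k) \<omega>))\<^sup>2)
        - 2 * h \<omega> * (\<Sum>k\<in>UNIV. \<E> (\<omega> 0) k * h (shift (step k) \<omega>)) + (h \<omega>)\<^sup>2 * (\<Sum>k\<in>UNIV. \<E> (\<omega> 0) k)"
      by (simp add: power2_eq_square algebra_simps sum.distrib sum_subtractf sum_distrib_left)
    then show ?thesis
      using env_path_law_invariant_harmonic[OF A \<omega>] sum_prob[OF \<omega>, of 0]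
      by (simp add: h_def[symmetric] power2_eq_square)
  qed
  note [measurable_cong] = \<nu>(2)
  let ?V = "\<lambda>\<omega>. \<Sum>k\<in>UNIV. \<E> (\<omega> 0) k * (h (shift (step k) \<omega>) - h \<omega>)\<^sup>2"
  have V_nonneg: "0 \<le> ?V \<omega>" if "\<omega> \<in> space env_borel" for \<omega>
    using that by (intro sum_nonneg) (simp add: prob_nonneg)
  have "(\<integral>\<^sup>+\<omega>. ennreal (?V \<omega>) \<partial>\<nu>) + (\<integral>\<^sup>+\<omega>. ennreal ((h \<omega>)\<^sup>2) \<partial>\<nu>) =
      (\<integral>\<^sup>+\<omega>. ennreal (?V \<omega>) + ennreal ((h \<omega>)\<^sup>2) \<partial>\<nu>)"
    by (rule nn_integral_add[symmetric]) measurable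
  also have "\<dots> = (\<integral>\<^sup>+\<omega>. (\<Sum>k\<in>UNIV. ennreal (\<E> (\<omega> 0) k) * ennreal ((h (shift (step k) \<omega>))\<^sup>2)) \<partial>\<nu>)"
  proof (rule nn_integral_cong)
    fix \<omega> assume "\<omega> \<in> space \<nu>"
    then have \<omega>: "\<omega> \<in> space env_borel" by (simp add: space)
    then show "ennreal (?V \<omega>) + ennreal ((h \<omega>)\<^sup>2) =
        (\<Sum>k\<in>UNIV. ennreal (\<E> (\<omega> 0) k) * ennreal ((h (shift (step k) \<omega>))\<^sup>2))"
      using V_nonneg variance by (simp add: ennreal_plus[symmetric] prob_nonneg ennreal_mult[symmetric] sum_ennreal del: ennreal_plus)
  qed
  also have "\<dots> = (\<integral>\<^sup>+\<omega>. ennreal ((h \<omega>)\<^sup>2) \<partial>\<nu>)"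
    by (rule env_invariant_nn_integral[OF inv \<nu>(2), of "\<lambda>\<omega>. ennreal ((h \<omega>)\<^sup>2)"]) measurable
  finally have eq: "(\<integral>\<^sup>+\<omega>. ennreal (?V \<omega>) \<partial>\<nu>) + (\<integral>\<^sup>+\<omega>. ennreal ((h \<omega>)\<^sup>2) \<partial>\<nu>) = (\<integral>\<^sup>+\<omega>. ennreal ((h \<omega>)\<^sup>2) \<partial>\<nu>)" .
  have "(\<integral>\<^sup>+\<omega>. ennreal ((h \<omega>)\<^sup>2) \<partial>\<nu>) \<le> (\<integral>\<^sup>+\<omega>. 1 \<partial>\<nu>)"
    using h_nonneg h_le_1 by (intro nn_integral_mono) (simp add: space power_le_one)
  then have "(\<integral>\<^sup>+\<omega>. ennreal ((h \<omega>)\<^sup>2) \<partial>\<nu>) \<noteq> \<top>"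
    using nu.emeasure_space_1 by (auto simp: top_unique)
  \<comment> \<open>By invariance h^2 and its one-step mean have the same integral. As this integral
    is finite it cancels, and the integrated variance is 0.\<close>
  with eq have "(\<integral>\<^sup>+\<omega>. ennreal (?V \<omega>) \<partial>\<nu>) = 0"
    by (rule ennreal_add_eq_right_imp_0)
  then have "AE \<omega> in \<nu>. ennreal (?V \<omega>) = 0"
    by (subst (asm) nn_integral_0_iff_AE) measurable
  then have "AE \<omega> in \<nu>. ?V \<omega> = 0"
    using AE_space
  proof eventually_elim
    case (elim \<omega>)
    with V_nonneg[of \<omega>] show ?case by (simp add: space ennreal_eq_0_iff)
  qed
  moreover have "AE \<omega> in \<nu>. \<forall>k. 0 < \<E> (\<omega> 0) k"
    using absolutely_continuous_AE[OF _ ac pos] \<mu>(2) \<nu>(2) by simp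
  ultimately have "AE \<omega> in \<nu>. \<forall>k. h (shift (step k) \<omega>) = h \<omega>"
    using AE_space
  proof eventually_elim
    case (elim \<omega>)
    then have "\<E> (\<omega> 0) k * (h (shift (step k) \<omega>) - h \<omega>)\<^sup>2 = 0" for k
      by (subst (asm) sum_nonneg_eq_0_iff) (auto simp: space prob_nonneg)
    with elim(2) show ?case by (auto simp: less_le)
  qed
  \<comment> \<open>Shift stationarity is available for \<mu>, so the almost sure identity is
    carried from \<nu> to \<mu> before all translates are taken.\<close>
  moreover have "absolutely_continuous \<nu> \<mu>"
    by (rule env_invariant_dominates[OF \<mu> erg pos \<nu> inv ac])
  ultimately have "AE \<omega> in \<mu>. \<forall>k. h (shift (step k) \<omega>) = h \<omega>"
    using absolutely_continuous_AE[of \<mu> \<nu>] \<mu>(2) \<nu>(2) by simp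
  from AE_all_shifts[OF erg(1) this]
  have const: "AE \<omega> in \<mu>. \<forall>x. h (shift x \<omega>) = h \<omega>"
  proof eventually_elim
    case (elim \<omega>)
    show ?case
    proof
      show "h (shift x \<omega>) = h \<omega>" for x
      proof (induction x rule: lattice_induct)
        case (step x k)
        then show ?case using elim by (simp add: shift_add)
      qed simp
    qed
  qed
  \<comment> \<open>Constancy along the orbit is built into \<open>G\<close>, so that
    \<open>G\<close> is invariant exactly and not merely up to a null set, as
    \<open>ergodic_under\<close> demands.\<close>
  define G where "G = {\<omega> \<in> space env_borel. (\<forall>x. h (shift x \<omega>) = h \<omega>) \<and> h \<omega> = 1}"
  have G: "G \<in> sets \<mu>"
  proof -
    have [measurable]: "Measurable.pred env_borel (\<lambda>\<omega>. h (shift x \<omega>) = h \<omega>)"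
      "Measurable.pred env_borel (\<lambda>\<omega>. h \<omega> = 1)" for x
      unfolding pred_def by (rule borel_measurable_eq; measurable)+
    show ?thesis unfolding G_def \<mu>(2) by measurable
  qed
  have "shift y -` G \<inter> space \<mu> = G" for y
  proof -
    have "shift y \<omega> \<in> G \<longleftrightarrow> \<omega> \<in> G" if "\<omega> \<in> space env_borel" for \<omega>
    proof
      assume "shift y \<omega> \<in> G"
      then have *: "h (shift (y + x) \<omega>) = 1" for x
        by (simp add: G_def shift_add)
      have "h (shift x \<omega>) = 1" for x using *[of "x - y"] by simp
      from this[of 0] this show "\<omega> \<in> G" using that by (simp add: G_def)
    next
      assume "\<omega> \<in> G"
      then show "shift y \<omega> \<in> G"
        by (simp add: G_def shift_add[symmetric])
    qed
    moreover have "G \<subseteq> space env_borel" by (auto simp: G_def)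
    ultimately show ?thesis by (auto simp: space)
  qed
  then have "measure \<mu> G \<in> {0, 1}"
    using erg(2) G unfolding ergodic_under_def by auto
  moreover have AE_G: "AE \<omega> in \<mu>. (\<omega> \<in> G \<longrightarrow> h \<omega> = 1) \<and> (\<omega> \<notin> G \<longrightarrow> h \<omega> = 0)"
    using const AE_space
  proof eventually_elim
    case (elim \<omega>)
    then have \<omega>: "\<omega> \<in> space env_borel" by (simp add: space)
    \<comment> \<open>Independence of \<open>A\<close> from itself gives h = h^2, so
      \<open>h\<close> takes only the values 0 and 1.\<close>
    have "emeasure (env_path_law \<omega>) (A \<inter> A) = ennreal (h \<omega>) * emeasure (env_path_law \<omega>) A"
      using elim(1) \<omega> by (intro env_path_law_Int_invariant[OF A \<omega> _ A(1)]) (simp add: h_emeasure)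
    then have "h \<omega> = h \<omega> * h \<omega>"
      using h_emeasure[OF \<omega>] by (simp add: ennreal_mult[symmetric] h_nonneg)
    then have "h \<omega> = 0 \<or> h \<omega> = 1" by auto
    then show ?case using elim(1) \<omega> by (auto simp: G_def)
  qed
  have M_A: "emeasure ?M A = (\<integral>\<^sup>+\<omega>. ennreal (h \<omega>) \<partial>\<nu>)"
    unfolding env_process_law(2)[OF \<nu> A(1)] by (intro nn_integral_cong) (simp add: h_emeasure space)
  have "emeasure ?M A = 0 \<or> emeasure ?M A = 1"
  proof (cases "measure \<mu> G = 1")
    case True
    then have "AE \<omega> in \<mu>. \<omega> \<in> G" using G by (simp add: mu.AE_in_set_eq_1)
    with AE_G have "AE \<omega> in \<mu>. h \<omega> = 1" by eventually_elim auto
    then have "AE \<omega> in \<nu>. h \<omega> = 1"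
      using absolutely_continuous_AE[OF _ ac] \<mu>(2) \<nu>(2) by simp
    then have "(\<integral>\<^sup>+\<omega>. ennreal (h \<omega>) \<partial>\<nu>) = (\<integral>\<^sup>+\<omega>. 1 \<partial>\<nu>)"
      by (intro nn_integral_cong_AE) auto
    then show ?thesis by (simp add: M_A nu.emeasure_space_1)
  next
    case False
    with \<open>measure \<mu> G \<in> {0, 1}\<close> have "G \<in> null_sets \<mu>"
      using G by (auto simp: null_sets_def mu.emeasure_eq_measure)
    from AE_not_in[OF this] AE_G have "AE \<omega> in \<mu>. h \<omega> = 0" by eventually_elim auto
    then have "AE \<omega> in \<nu>. h \<omega> = 0"
      using absolutely_continuous_AE[OF _ ac] \<mu>(2) \<nu>(2) by simp
    then have "(\<integral>\<^sup>+\<omega>. ennreal (h \<omega>) \<partial>\<nu>) = (\<integral>\<^sup>+\<omega>. 0 \<partial>\<nu>)"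
      by (intro nn_integral_cong_AE) auto
    then show ?thesis by (simp add: M_A)
  qed
  then show "measure ?M A \<in> {0, 1}" by (auto simp: measure_def)
qed

end

section \<open>The invariant measure\<close>

text \<open>By balancedness the product over all nonzero steps is the square of the forward product,
  so for positive probabilities \<open>W\<close> is the power -d of the geometric mean
  \<open>step_gmean \<E> 0\<close>.\<close>

locale balanced_environment = environment_function \<E> + prob_space \<mu>
  for \<E> :: "('d::finite dir \<Rightarrow> real) \<Rightarrow> ('d dir \<Rightarrow> real)" and \<mu> :: "'d environment measure" +
  fixes W :: "'d environment \<Rightarrow> real"
  defines "W \<omega> \<equiv> 1 / (\<Prod>i\<in>UNIV. \<E> (\<omega> 0) (Fwd i))"
  assumes sets_\<mu> [measurable_cong]: "sets \<mu> = sets env_borel"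
    and stationary: "stationary_under \<mu> (range shift)"
    and balanced: "\<omega> \<in> space env_borel \<Longrightarrow> \<E> (\<omega> x) (Fwd i) = \<E> (\<omega> x) (Bwd i)"
    and elliptic: "AE \<omega> in \<mu>. \<forall>x k. 0 < \<E> (\<omega> x) k"
    and integrable_W: "integrable \<mu> W"
begin

lemma space_\<mu>: "space \<mu> = space env_borel"
  by (rule sets_eq_imp_space_eq[OF sets_\<mu>])

lemma walk: "\<omega> \<in> space env_borel \<Longrightarrow> balanced_lattice_walk (\<lambda>x. \<E> (\<omega> x))"
  by unfold_locales (auto simp: prob_in_simplex balanced)

lemma integral_shift:
  "g \<in> borel_measurable env_borel \<Longrightarrow> (\<integral>\<omega>. g (shift x \<omega>) \<partial>\<mu>) = (\<integral>\<omega>. g \<omega> \<partial>\<mu> :: real)"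
  using integral_distr[OF stationary_under_shiftD(1)[OF stationary], of g x] stationary_under_shiftD(2)[OF stationary]
  by simp

lemma integrable_shift:
  fixes g :: "'d environment \<Rightarrow> real"
  shows "integrable \<mu> g \<Longrightarrow> integrable \<mu> (\<lambda>\<omega>. g (shift x \<omega>))"
  using integrable_distr[OF stationary_under_shiftD(1)[OF stationary], of x g] stationary_under_shiftD(2)[OF stationary]
  by simp

lemma W_nonneg: "\<omega> \<in> space env_borel \<Longrightarrow> 0 \<le> W \<omega>"
  by (simp add: W_def prod_nonneg prob_nonneg)

section \<open>Averages of the killed Green function over the environment\<close>

definition env_green :: "nat \<Rightarrow> nat \<Rightarrow> ('d environment \<Rightarrow> real) \<Rightarrow> 'd environment \<Rightarrow> real" where
  "env_green L n g \<omega> = killed_green (\<lambda>x. \<E> (\<omega> x)) L (\<lambda>x. g (shift x \<omega>)) n 0"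

lemma measurable_env_green [measurable]:
  assumes [measurable]: "g \<in> borel_measurable env_borel"
  shows "env_green L n g \<in> borel_measurable env_borel"
proof -
  have "(\<lambda>\<omega>. killed_green (\<lambda>x. \<E> (\<omega> x)) L (\<lambda>x. g (shift x \<omega>)) n x) \<in> borel_measurable env_borel" for x
  proof (induction n arbitrary: x)
    case (Suc n)
    note [measurable] = Suc
    show ?case by (cases "x \<in> lattice_cube L") (simp_all add: walk_op_def)
  qed simp
  then show ?thesis by (simp add: env_green_def[abs_def])
qed

lemma integrable_env_green:
  assumes g: "g \<in> borel_measurable env_borel" "\<And>\<omega>. \<omega> \<in> space env_borel \<Longrightarrow> \<bar>g \<omega>\<bar> \<le> c"
  shows "integrable \<mu> (env_green L n g)"
proof (rule integrable_const_bound[of _ "n * c"])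
  show "AE \<omega> in \<mu>. norm (env_green L n g \<omega>) \<le> n * c"
  proof (rule AE_I2)
    fix \<omega> assume "\<omega> \<in> space \<mu>"
    then have \<omega>: "\<omega> \<in> space env_borel" by (simp add: space_\<mu>)
    interpret balanced_lattice_walk "\<lambda>x. \<E> (\<omega> x)" by (rule walk[OF \<omega>])
    show "norm (env_green L n g \<omega>) \<le> n * c"
      unfolding env_green_def real_norm_def using \<omega> by (intro abs_killed_green_le g(2)) simp
  qed
qed (use g in measurable)

text \<open>Diffusive scaling: a cube of radius L, a time horizon L^2 and division by L^2, with L =
  \<open>Suc m\<close> to exclude L = 0.\<close>

definition killed_average :: "nat \<Rightarrow> ('d environment \<Rightarrow> real) \<Rightarrow> real" where
  "killed_average m g = (\<integral>\<omega>. env_green (Suc m) ((Suc m)\<^sup>2) g \<omega> \<partial>\<mu>) / (real (Suc m))\<^sup>2"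

definition bounded_nonneg :: "('d environment \<Rightarrow> real) set" where
  "bounded_nonneg = {g \<in> borel_measurable env_borel. \<exists>c. \<forall>\<omega>\<in>space env_borel. 0 \<le> g \<omega> \<and> g \<omega> \<le> c}"

lemma bounded_nonneg_bound:
  assumes "g \<in> bounded_nonneg"
  obtains c where "0 < c" "\<And>\<omega>. \<omega> \<in> space env_borel \<Longrightarrow> 0 \<le> g \<omega> \<and> g \<omega> \<le> c"
proof -
  from assms obtain c where c: "\<And>\<omega>. \<omega> \<in> space env_borel \<Longrightarrow> 0 \<le> g \<omega> \<and> g \<omega> \<le> c"
    by (auto simp: bounded_nonneg_def)
  show ?thesis by (rule that[of "max c 1"]) (use c in \<open>auto simp: le_max_iff_disj\<close>)
qed

lemma bounded_nonneg_measurable: "g \<in> bounded_nonneg \<Longrightarrow> g \<in> borel_measurable env_borel"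
  by (simp add: bounded_nonneg_def)

lemma integrable_env_green':
  assumes "g \<in> bounded_nonneg"
  shows "integrable \<mu> (env_green L n g)"
proof -
  obtain c where "0 < c" "\<And>\<omega>. \<omega> \<in> space env_borel \<Longrightarrow> 0 \<le> g \<omega> \<and> g \<omega> \<le> c"
    using bounded_nonneg_bound[OF assms] by blast
  then show ?thesis
    using assms by (intro integrable_env_green[of _ c]) (auto simp: bounded_nonneg_def)
qed

lemma killed_average_add:
  assumes "g \<in> bounded_nonneg" "h \<in> bounded_nonneg"
  shows "killed_average m (\<lambda>\<omega>. g \<omega> + h \<omega>) = killed_average m g + killed_average m h"
proof -
  have "env_green L n (\<lambda>\<omega>. g \<omega> + h \<omega>) = (\<lambda>\<omega>. env_green L n g \<omega> + env_green L n h \<omega>)" for L n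
    by (simp add: env_green_def killed_green_add fun_eq_iff)
  then show ?thesis
    using assms by (simp add: killed_average_def integrable_env_green' add_divide_distrib)
qed

lemma killed_average_cmult: "killed_average m (\<lambda>\<omega>. c * g \<omega>) = c * killed_average m g"
proof -
  have "env_green L n (\<lambda>\<omega>. c * g \<omega>) = (\<lambda>\<omega>. c * env_green L n g \<omega>)" for L n
    by (simp add: env_green_def killed_green_cmult fun_eq_iff)
  then show ?thesis by (simp add: killed_average_def)
qed

lemma killed_average_nonneg:
  assumes "\<And>\<omega>. \<omega> \<in> space env_borel \<Longrightarrow> 0 \<le> g \<omega>"
  shows "0 \<le> killed_average m g"
proof -
  have "0 \<le> env_green L n g \<omega>" if \<omega>: "\<omega> \<in> space env_borel" for L n \<omega>
  proof -
    interpret balanced_lattice_walk "\<lambda>x. \<E> (\<omega> x)" by (rule walk[OF \<omega>])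
    show ?thesis unfolding env_green_def using assms \<omega> by (intro killed_green_nonneg) simp
  qed
  then show ?thesis
    by (auto simp: killed_average_def space_\<mu> intro!: divide_nonneg_nonneg integral_nonneg_AE)
qed

text \<open>The walk spends a time of order L^2 in the cube; this keeps the limiting functional from
  being zero.\<close>

lemma killed_average_one: "1 / 2 \<le> killed_average m (indicator (space env_borel))"
proof -
  let ?L = "Suc m"
  have "(real ?L)\<^sup>2 / 2 \<le> env_green ?L (?L\<^sup>2) (indicator (space env_borel)) \<omega>" if \<omega>: "\<omega> \<in> space env_borel" for \<omega>
  proof -
    interpret balanced_lattice_walk "\<lambda>x. \<E> (\<omega> x)" by (rule walk[OF \<omega>])
    show ?thesis
      using killed_green_1_ge[of ?L] \<omega> by (simp add: env_green_def del: killed_green.simps)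
  qed
  then have "(\<integral>\<omega>. (real ?L)\<^sup>2 / 2 \<partial>\<mu>) \<le> (\<integral>\<omega>. env_green ?L (?L\<^sup>2) (indicator (space env_borel)) \<omega> \<partial>\<mu>)"
    by (intro integral_mono integrable_env_green[of _ 1]) (auto simp: space_\<mu> indicator_def)
  then show ?thesis
    by (simp add: killed_average_def prob_space field_simps del: of_nat_Suc)
qed

definition env_op :: "('d environment \<Rightarrow> real) \<Rightarrow> 'd environment \<Rightarrow> real" where
  "env_op g \<omega> = (\<Sum>k\<in>UNIV. \<E> (\<omega> 0) k * g (shift (step k) \<omega>))"

lemma env_op_bounds:
  assumes "\<And>\<omega>. \<omega> \<in> space env_borel \<Longrightarrow> 0 \<le> g \<omega> \<and> g \<omega> \<le> c" and \<omega>: "\<omega> \<in> space env_borel"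
  shows "0 \<le> env_op g \<omega>" "env_op g \<omega> \<le> c"
proof -
  show "0 \<le> env_op g \<omega>"
    using assms unfolding env_op_def by (intro sum_nonneg mult_nonneg_nonneg) (auto simp: prob_nonneg)
  have "env_op g \<omega> \<le> (\<Sum>k\<in>UNIV. \<E> (\<omega> 0) k * c)"
    using assms unfolding env_op_def by (intro sum_mono mult_left_mono) (auto simp: prob_nonneg)
  then show "env_op g \<omega> \<le> c" using \<omega> by (simp add: sum_distrib_right[symmetric] sum_prob)
qed

lemma env_op_bounded_nonneg: "g \<in> bounded_nonneg \<Longrightarrow> env_op g \<in> bounded_nonneg"
proof -
  assume g: "g \<in> bounded_nonneg"
  then obtain c where "0 < c" "\<And>\<omega>. \<omega> \<in> space env_borel \<Longrightarrow> 0 \<le> g \<omega> \<and> g \<omega> \<le> c"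
    using bounded_nonneg_bound by blast
  moreover have "env_op g \<in> borel_measurable env_borel"
  proof -
    note [measurable] = bounded_nonneg_measurable[OF g]
    show ?thesis unfolding env_op_def[abs_def] by measurable
  qed
  ultimately show ?thesis
    using env_op_bounds[of g c] by (auto simp: bounded_nonneg_def)
qed

text \<open>Along an orbit \<open>env_op\<close> becomes \<open>walk_op\<close>, so the difference
  is the killed Green function of a coboundary. That is bounded by \<open>c\<close> for every L, and
  the normalization supplies the decay.\<close>

lemma killed_average_env_op:
  assumes g: "g \<in> bounded_nonneg" "\<And>\<omega>. \<omega> \<in> space env_borel \<Longrightarrow> g \<omega> \<le> c"
  shows "\<bar>killed_average m (env_op g) - killed_average m g\<bar> \<le> c / (real (Suc m))\<^sup>2"
proof -
  let ?L = "Suc m" let ?n = "(Suc m)\<^sup>2"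
  have "\<bar>env_green ?L ?n (env_op g) \<omega> - env_green ?L ?n g \<omega>\<bar> \<le> c" if \<omega>: "\<omega> \<in> space env_borel" for \<omega>
  proof -
    interpret balanced_lattice_walk "\<lambda>x. \<E> (\<omega> x)" by (rule walk[OF \<omega>])
    let ?f = "\<lambda>x. g (shift x \<omega>)"
    have op: "env_op g (shift x \<omega>) = walk_op (\<lambda>x. \<E> (\<omega> x)) ?f x" for x
      by (simp add: env_op_def walk_op_def shift_apply_0 shift_add)
    have "killed_green (\<lambda>x. \<E> (\<omega> x)) ?L (walk_op (\<lambda>x. \<E> (\<omega> x)) ?f) ?n 0 =
        killed_green (\<lambda>x. \<E> (\<omega> x)) ?L (\<lambda>x. walk_op (\<lambda>x. \<E> (\<omega> x)) ?f x - ?f x) ?n 0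
        + killed_green (\<lambda>x. \<E> (\<omega> x)) ?L ?f ?n 0"
      by (subst killed_green_add[symmetric]) simp
    moreover have "\<bar>killed_green (\<lambda>x. \<E> (\<omega> x)) ?L (\<lambda>x. walk_op (\<lambda>x. \<E> (\<omega> x)) ?f x - ?f x) ?n 0\<bar> \<le> c"
      using g \<omega> by (intro abs_killed_green_coboundary_le) (auto simp: bounded_nonneg_def)
    ultimately show ?thesis by (simp add: env_green_def op)
  qed
  then have "\<bar>\<integral>\<omega>. env_green ?L ?n (env_op g) \<omega> - env_green ?L ?n g \<omega> \<partial>\<mu>\<bar> \<le> (\<integral>\<omega>. c \<partial>\<mu>)"
    by (intro order_trans[OF integral_abs_bound] integral_mono integrable_abs Bochner_Integration.integrable_diff
          integrable_env_green' g env_op_bounded_nonneg) (auto simp: space_\<mu>)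
  then show ?thesis
    using g by (simp add: killed_average_def integrable_env_green' env_op_bounded_nonneg prob_space
      diff_divide_distrib[symmetric] abs_divide divide_right_mono del: of_nat_Suc)
qed

text \<open>The maximum principle controls the d-th power of the normalized Green function by a sum
  over the cube, which stationarity integrates. The point is that the constants do not depend on
  \<open>m\<close>, so the bound passes to the limit.\<close>

lemma killed_average_le:
  assumes g: "g \<in> bounded_nonneg" "\<And>\<omega>. \<omega> \<in> space env_borel \<Longrightarrow> g \<omega> \<le> 1" and \<delta>: "0 < \<delta>"
  shows "killed_average m g \<le> \<delta> + \<delta> * (CARD('d) / \<delta>) ^ CARD('d) * (\<integral>\<omega>. g \<omega> * W \<omega> \<partial>\<mu>)"
proof -
  let ?d = "CARD('d)"
  define L where "L = Suc m"
  define v where "v \<omega> = env_green L (L\<^sup>2) g \<omega> / (real L)\<^sup>2" for \<omega>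
  have L: "0 < real L" by (simp add: L_def)
  have g_nonneg: "0 \<le> g \<omega>" if "\<omega> \<in> space env_borel" for \<omega>
    using g(1) that by (auto simp: bounded_nonneg_def)
  note [measurable] = bounded_nonneg_measurable[OF g(1)]
  have W_meas [measurable]: "W \<in> borel_measurable env_borel"
    unfolding W_def[abs_def] by measurable
  have gW: "integrable \<mu> (\<lambda>\<omega>. g \<omega> * W \<omega>)"
  proof (rule Bochner_Integration.integrable_bound[OF integrable_W])
    show "AE \<omega> in \<mu>. norm (g \<omega> * W \<omega>) \<le> norm (W \<omega>)"
      using g g_nonneg by (intro AE_I2) (auto simp: space_\<mu> abs_mult intro!: mult_left_le_one_le)
  qed measurable
  have bound: "AE \<omega> in \<mu>. v \<omega> \<le> \<delta> + \<delta> * (?d / (2 * L * \<delta>)) ^ ?d *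
      (\<Sum>x\<in>lattice_cube L. g (shift x \<omega>) * W (shift x \<omega>))"
    using elliptic AE_space
  proof eventually_elim
    case (elim \<omega>)
    then have \<omega>: "\<omega> \<in> space env_borel" by (simp add: space_\<mu>)
    interpret balanced_lattice_walk "\<lambda>x. \<E> (\<omega> x)" by (rule walk[OF \<omega>])
    let ?S = "\<Sum>x\<in>lattice_cube L. g (shift x \<omega>) * W (shift x \<omega>)"
    have "(2 * env_green L (L\<^sup>2) g \<omega> / (?d * L)) ^ ?d \<le> ?S"
      using killed_green_le[of L "\<lambda>x. g (shift x \<omega>)" "L\<^sup>2"] elim(1) \<omega> g g_nonneg
      by (simp add: L_def env_green_def W_def shift_apply_0 del: killed_green.simps)
    moreover have "2 * env_green L (L\<^sup>2) g \<omega> / (?d * L) = v \<omega> / \<delta> * (2 * L * \<delta> / ?d)"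
      using L \<delta> by (simp add: v_def power2_eq_square field_simps)
    ultimately have "(v \<omega> / \<delta>) ^ ?d * (2 * L * \<delta> / ?d) ^ ?d \<le> ?S"
      by (simp only: power_mult_distrib)
    then have "(v \<omega> / \<delta>) ^ ?d \<le> ?S / (2 * L * \<delta> / ?d) ^ ?d"
      using L \<delta> by (simp add: le_divide_eq)
    also have "\<dots> = (?d / (2 * L * \<delta>)) ^ ?d * ?S"
      by (simp add: power_divide)
    finally have le: "(v \<omega> / \<delta>) ^ ?d \<le> (?d / (2 * L * \<delta>)) ^ ?d * ?S" .
    have S: "0 \<le> ?S" using \<omega> g_nonneg by (intro sum_nonneg mult_nonneg_nonneg) (auto simp: W_nonneg)
    show ?case
    proof (cases "v \<omega> \<le> \<delta>")
      case True
      have "0 \<le> \<delta> * (?d / (2 * L * \<delta>)) ^ ?d * ?S" using S \<delta> by simp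
      with True show ?thesis by linarith
    next
      case False
      \<comment> \<open>For t > 1 one has t \<le> t^d. This removes the power without taking a root
        and keeps the bound linear in \<open>g\<close>; the values up to \<delta> are paid for by
        the additive \<delta>.\<close>
      then have "(v \<omega> / \<delta>) ^ 1 \<le> (v \<omega> / \<delta>) ^ ?d"
        using \<delta> by (intro power_increasing) (auto simp: Suc_le_eq)
      with le have "v \<omega> / \<delta> \<le> (?d / (2 * L * \<delta>)) ^ ?d * ?S" by simp
      then have "v \<omega> \<le> \<delta> * (?d / (2 * L * \<delta>)) ^ ?d * ?S"
        using \<delta> by (simp add: pos_divide_le_eq mult_ac)
      with \<delta> show ?thesis by linarith
    qed
  qed
  have int_S: "integrable \<mu> (\<lambda>\<omega>. \<Sum>x\<in>lattice_cube L. g (shift x \<omega>) * W (shift x \<omega>))"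
    by (intro Bochner_Integration.integrable_sum integrable_shift[OF gW])
  have "killed_average m g = (\<integral>\<omega>. v \<omega> \<partial>\<mu>)"
    by (simp add: killed_average_def v_def L_def)
  also have "\<dots> \<le> (\<integral>\<omega>. \<delta> + \<delta> * (?d / (2 * L * \<delta>)) ^ ?d * (\<Sum>x\<in>lattice_cube L. g (shift x \<omega>) * W (shift x \<omega>)) \<partial>\<mu>)"
    using bound int_S integrable_env_green'[OF g(1)] by (intro integral_mono_AE) (auto simp: v_def[abs_def])
  \<comment> \<open>By stationarity every lattice point contributes the same integral.\<close>
  also have "\<dots> = \<delta> + \<delta> * (?d / (2 * L * \<delta>)) ^ ?d * (\<Sum>x\<in>(lattice_cube L :: (int ^ 'd) set). \<integral>\<omega>. g \<omega> * W \<omega> \<partial>\<mu>)"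
    using int_S integrable_shift[OF gW] integral_shift[of "\<lambda>\<omega>. g \<omega> * W \<omega>"]
    by (simp add: prob_space Bochner_Integration.integral_sum)
  also have "\<dots> \<le> \<delta> + \<delta> * (?d / (2 * L * \<delta>)) ^ ?d * ((2 * L) ^ ?d * (\<integral>\<omega>. g \<omega> * W \<omega> \<partial>\<mu>))"
  proof -
    have "real (card (lattice_cube L :: (int ^ 'd) set)) \<le> (2 * real L) ^ ?d"
      using card_lattice_cube[where L=L and 'd='d] by (metis of_nat_le_iff of_nat_mult of_nat_numeral of_nat_power)
    moreover have "0 \<le> (\<integral>\<omega>. g \<omega> * W \<omega> \<partial>\<mu>)"
      by (intro integral_nonneg_AE AE_I2 mult_nonneg_nonneg) (auto simp: space_\<mu> g_nonneg W_nonneg)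
    ultimately have "real (card (lattice_cube L :: (int ^ 'd) set)) * (\<integral>\<omega>. g \<omega> * W \<omega> \<partial>\<mu>)
        \<le> (2 * real L) ^ ?d * (\<integral>\<omega>. g \<omega> * W \<omega> \<partial>\<mu>)"
      by (rule mult_right_mono)
    then show ?thesis
      unfolding sum_constant using \<delta> by (intro add_left_mono mult_left_mono) auto
  qed
  also have "\<dots> = \<delta> + \<delta> * ((?d / (2 * L * \<delta>)) ^ ?d * (2 * L) ^ ?d) * (\<integral>\<omega>. g \<omega> * W \<omega> \<partial>\<mu>)"
    by (simp only: mult_ac)
  \<comment> \<open>The bound on the number of points cancels the remaining power of L.\<close>
  also have "(?d / (2 * L * \<delta>)) ^ ?d * (2 * L) ^ ?d = (?d / \<delta>) ^ ?d"
  proof -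
    have "?d / (2 * L * \<delta>) * real (2 * L) = ?d / \<delta>" using L \<delta> by simp
    then show ?thesis by (simp only: of_nat_power power_mult_distrib[symmetric])
  qed
  finally show ?thesis .
qed

text \<open>The limit of the averages along a filter is positive, additive and invariant. Since
  \<delta> is fixed before the integral against \<open>W\<close> becomes small,
  \<open>killed_average_le\<close> yields both continuity and absolute continuity.\<close>

lemma ex_invariant_measure:
  "\<exists>\<nu>. prob_space \<nu> \<and> sets \<nu> = sets env_borel \<and> env_invariant \<nu> \<and> absolutely_continuous \<mu> \<nu>"
proof -
  let ?d = "CARD('d)"
  \<comment> \<open>Homogeneity: the bound for functions at most 1 is applied to g / c and
    multiplied by c.\<close>
  have scaled: "killed_average m g \<le> c * \<delta> + \<delta> * (?d / \<delta>) ^ ?d * (\<integral>\<omega>. g \<omega> * W \<omega> \<partial>\<mu>)"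
    if g: "g \<in> bounded_nonneg" "\<And>\<omega>. \<omega> \<in> space env_borel \<Longrightarrow> g \<omega> \<le> c" and "0 < c" "0 < \<delta>" for g c \<delta> m
  proof -
    have "(\<lambda>\<omega>. 1 / c * g \<omega>) \<in> bounded_nonneg"
      using g \<open>0 < c\<close> by (auto simp: bounded_nonneg_def intro!: exI[of _ 1])
    then have "killed_average m (\<lambda>\<omega>. 1 / c * g \<omega>) \<le>
        \<delta> + \<delta> * (?d / \<delta>) ^ ?d * (\<integral>\<omega>. 1 / c * g \<omega> * W \<omega> \<partial>\<mu>)"
      using g \<open>0 < c\<close> \<open>0 < \<delta>\<close> by (intro killed_average_le) auto
    then have "c * killed_average m (\<lambda>\<omega>. 1 / c * g \<omega>) \<le>
        c * (\<delta> + \<delta> * (?d / \<delta>) ^ ?d * (\<integral>\<omega>. 1 / c * g \<omega> * W \<omega> \<partial>\<mu>))"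
      using \<open>0 < c\<close> by (intro mult_left_mono) auto
    also have "\<dots> = c * \<delta> + \<delta> * (?d / \<delta>) ^ ?d * (\<integral>\<omega>. g \<omega> * W \<omega> \<partial>\<mu>)"
      using \<open>0 < c\<close> by (simp add: mult.assoc distrib_left)
    also have "c * killed_average m (\<lambda>\<omega>. 1 / c * g \<omega>) = killed_average m g"
      using \<open>0 < c\<close> unfolding killed_average_cmult by simp
    finally show ?thesis .
  qed
  have bseq: "Bseq (\<lambda>m. killed_average m g)" if g: "g \<in> bounded_nonneg" for g
  proof -
    obtain c where c: "0 < c" "\<And>\<omega>. \<omega> \<in> space env_borel \<Longrightarrow> 0 \<le> g \<omega> \<and> g \<omega> \<le> c"
      using bounded_nonneg_bound[OF g] by blast
    show ?thesis
      using scaled[OF g, of c 1] killed_average_nonneg[of g] c by (intro BseqI') auto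
  qed
  obtain G where G: "G \<noteq> bot" "G \<le> sequentially"
    and "\<And>g. Bseq (\<lambda>m. killed_average m g) \<Longrightarrow> \<exists>l. ((\<lambda>m. killed_average m g) \<longlongrightarrow> l) G"
    using ex_generalized_limit[of killed_average] by blast
  with bseq have "\<forall>g\<in>bounded_nonneg. \<exists>l. ((\<lambda>m. killed_average m g) \<longlongrightarrow> l) G" by blast
  then obtain \<Lambda> where \<Lambda>: "\<And>g. g \<in> bounded_nonneg \<Longrightarrow> ((\<lambda>m. killed_average m g) \<longlongrightarrow> \<Lambda> g) G"
    by metis
  have ind: "indicator A \<in> bounded_nonneg" if "A \<in> sets env_borel" for A
    using that by (auto simp: bounded_nonneg_def indicator_def intro!: exI[of _ 1])
  have \<Lambda>_nonneg: "0 \<le> \<Lambda> g" if g: "g \<in> bounded_nonneg" for g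
    using g by (intro tendsto_lowerbound[OF \<Lambda>[OF g] _ G(1)] always_eventually allI killed_average_nonneg)
      (auto simp: bounded_nonneg_def)
  have \<Lambda>_le: "\<Lambda> g \<le> c * \<delta> + \<delta> * (?d / \<delta>) ^ ?d * (\<integral>\<omega>. g \<omega> * W \<omega> \<partial>\<mu>)"
    if g: "g \<in> bounded_nonneg" "\<And>\<omega>. \<omega> \<in> space env_borel \<Longrightarrow> g \<omega> \<le> c" "0 < c" "0 < \<delta>" for g c \<delta>
    using g by (intro tendsto_upperbound[OF \<Lambda>[OF g(1)] _ G(1)] always_eventually allI scaled)
  have \<Lambda>_add: "\<Lambda> (\<lambda>\<omega>. g \<omega> + h \<omega>) = \<Lambda> g + \<Lambda> h" if gh: "g \<in> bounded_nonneg" "h \<in> bounded_nonneg" for g h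
  proof -
    obtain a b where ab: "\<And>\<omega>. \<omega> \<in> space env_borel \<Longrightarrow> 0 \<le> g \<omega> \<and> g \<omega> \<le> a"
        "\<And>\<omega>. \<omega> \<in> space env_borel \<Longrightarrow> 0 \<le> h \<omega> \<and> h \<omega> \<le> b"
      using bounded_nonneg_bound[OF gh(1)] bounded_nonneg_bound[OF gh(2)] by metis
    have "(\<lambda>\<omega>. g \<omega> + h \<omega>) \<in> bounded_nonneg"
      using gh ab by (auto simp: bounded_nonneg_def intro!: exI[of _ "a + b"] add_nonneg_nonneg add_mono)
    from \<Lambda>[OF this] tendsto_add[OF \<Lambda>[OF gh(1)] \<Lambda>[OF gh(2)]] show ?thesis
      using G(1) by (simp add: killed_average_add[OF gh] tendsto_unique)
  qed
  have \<Lambda>_cmult: "\<Lambda> (\<lambda>\<omega>. c * g \<omega>) = c * \<Lambda> g" if "0 \<le> c" and g: "g \<in> bounded_nonneg" for c g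
  proof -
    obtain a where "\<And>\<omega>. \<omega> \<in> space env_borel \<Longrightarrow> 0 \<le> g \<omega> \<and> g \<omega> \<le> a"
      using bounded_nonneg_bound[OF g] by blast
    then have "(\<lambda>\<omega>. c * g \<omega>) \<in> bounded_nonneg"
      using g \<open>0 \<le> c\<close> by (auto simp: bounded_nonneg_def intro!: exI[of _ "c * a"] mult_left_mono)
    from \<Lambda>[OF this] tendsto_mult[OF tendsto_const \<Lambda>[OF g], of c] show ?thesis
      using G(1) by (simp add: killed_average_cmult tendsto_unique)
  qed
  \<comment> \<open>The error c / L^2 tends to 0 along the sequence, hence along
    \<open>G\<close>.\<close>
  have \<Lambda>_op: "\<Lambda> (env_op g) = \<Lambda> g" if g: "g \<in> bounded_nonneg" for g
  proof -
    obtain c where c: "\<And>\<omega>. \<omega> \<in> space env_borel \<Longrightarrow> 0 \<le> g \<omega> \<and> g \<omega> \<le> c"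
      using bounded_nonneg_bound[OF g] by blast
    have "(\<lambda>m. c * (inverse (real (Suc m)))\<^sup>2) \<longlonglongrightarrow> c * 0\<^sup>2"
      by (intro tendsto_intros LIMSEQ_inverse_real_of_nat)
    then have "(\<lambda>m. c / (real (Suc m))\<^sup>2) \<longlonglongrightarrow> 0"
      by (simp add: divide_inverse power_inverse)
    then have "(\<lambda>m. killed_average m (env_op g) - killed_average m g) \<longlonglongrightarrow> 0"
    proof (rule Lim_null_comparison[OF always_eventually, rotated])
      show "\<forall>m. norm (killed_average m (env_op g) - killed_average m g) \<le> c / (real (Suc m))\<^sup>2"
        unfolding real_norm_def by (intro allI killed_average_env_op[OF g]) (use c in blast)
    qed
    then have "((\<lambda>m. killed_average m (env_op g) - killed_average m g) \<longlongrightarrow> 0) G"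
      using G(2) by (rule tendsto_mono[rotated])
    with tendsto_diff[OF \<Lambda>[OF env_op_bounded_nonneg[OF g]] \<Lambda>[OF g]]
    have "\<Lambda> (env_op g) - \<Lambda> g = 0" by (rule tendsto_unique[OF G(1)])
    then show ?thesis by simp
  qed
  have \<Lambda>_one: "1 / 2 \<le> \<Lambda> (indicator (space env_borel))"
    by (intro tendsto_lowerbound[OF \<Lambda> _ G(1)] always_eventually allI killed_average_one ind) simp
  have \<Lambda>_cont: "(\<lambda>i. \<Lambda> (g i)) \<longlonglongrightarrow> 0"
    if g: "\<And>i. g i \<in> borel_measurable env_borel" "\<And>i \<omega>. \<omega> \<in> space env_borel \<Longrightarrow> 0 \<le> g i \<omega> \<and> g i \<omega> \<le> c"
      and lim: "\<And>\<omega>. \<omega> \<in> space env_borel \<Longrightarrow> (\<lambda>i. g i \<omega>) \<longlonglongrightarrow> 0" for g :: "nat \<Rightarrow> 'd environment \<Rightarrow> real" and c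
  proof -
    have B: "g i \<in> bounded_nonneg" for i using g by (auto simp: bounded_nonneg_def)
    note [measurable] = g(1)
    have "(\<lambda>i. \<integral>\<omega>. g i \<omega> * W \<omega> \<partial>\<mu>) \<longlonglongrightarrow> (\<integral>\<omega>. 0 \<partial>\<mu>)"
    proof (rule integral_dominated_convergence[where w="\<lambda>\<omega>. c * W \<omega>"])
      show "AE \<omega> in \<mu>. (\<lambda>i. g i \<omega> * W \<omega>) \<longlonglongrightarrow> 0"
        using lim by (intro AE_I2 tendsto_mult_left_zero) (simp add: space_\<mu>)
      show "AE \<omega> in \<mu>. norm (g i \<omega> * W \<omega>) \<le> c * W \<omega>" for i
        using g(2) by (intro AE_I2) (auto simp: space_\<mu> abs_mult W_nonneg intro!: mult_right_mono)
      show "(\<lambda>\<omega>. g i \<omega> * W \<omega>) \<in> borel_measurable \<mu>" for i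
        using integrable_W by measurable
    qed (use integrable_W in auto)
    then have I: "(\<lambda>i. \<integral>\<omega>. g i \<omega> * W \<omega> \<partial>\<mu>) \<longlonglongrightarrow> 0" by simp
    \<comment> \<open>The rescaling in \<open>scaled\<close> needs a positive bound, which
      \<open>c\<close> need not be.\<close>
    define b where "b = max c 1"
    have b: "0 < b" "\<And>i \<omega>. \<omega> \<in> space env_borel \<Longrightarrow> g i \<omega> \<le> b"
      using g(2) by (auto simp: b_def le_max_iff_disj)
    show ?thesis
    proof (rule order_tendstoI)
      fix a :: real assume "0 < a"
      \<comment> \<open>The first term of the bound becomes a / 2; with this \<delta> fixed, the
        second term tends to 0.\<close>
      define \<delta> where "\<delta> = a / (2 * b)"
      have \<delta>: "0 < \<delta>" "b * \<delta> = a / 2" using \<open>0 < a\<close> b(1) by (auto simp: \<delta>_def)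
      have "(\<lambda>i. b * \<delta> + \<delta> * (?d / \<delta>) ^ ?d * (\<integral>\<omega>. g i \<omega> * W \<omega> \<partial>\<mu>)) \<longlonglongrightarrow> b * \<delta> + \<delta> * (?d / \<delta>) ^ ?d * 0"
        by (intro tendsto_intros I)
      then have "\<forall>\<^sub>F i in sequentially. b * \<delta> + \<delta> * (?d / \<delta>) ^ ?d * (\<integral>\<omega>. g i \<omega> * W \<omega> \<partial>\<mu>) < a"
        by (rule order_tendstoD(2)) (use \<delta> \<open>0 < a\<close> in simp)
      then show "\<forall>\<^sub>F i in sequentially. \<Lambda> (g i) < a"
        by eventually_elim (rule le_less_trans[OF \<Lambda>_le[OF B b(2,1) \<delta>(1)]])
    next
      fix a :: real assume "a < 0"
      then show "\<forall>\<^sub>F i in sequentially. a < \<Lambda> (g i)"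
        using \<Lambda>_nonneg[OF B] by (intro always_eventually allI) (rule less_le_trans)
    qed
  qed
  \<comment> \<open>The total mass of the limit functional, at least 1/2; dividing by it gives a
    probability measure.\<close>
  define Z where "Z = \<Lambda> (indicator (space env_borel))"
  have Z: "0 < Z" using \<Lambda>_one by (simp add: Z_def)
  have "\<exists>\<nu>. prob_space \<nu> \<and> sets \<nu> = sets env_borel \<and>
      (\<forall>g\<in>{g \<in> borel_measurable env_borel. \<exists>c. \<forall>\<omega>\<in>space env_borel. 0 \<le> g \<omega> \<and> g \<omega> \<le> c}. integral\<^sup>L \<nu> g = \<Lambda> g / Z)"
  proof (rule ex_measure_of_functional, unfold bounded_nonneg_def[symmetric])
    show "(\<lambda>i. \<Lambda> (g i) / Z) \<longlonglongrightarrow> 0"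
      if "\<And>i. g i \<in> borel_measurable env_borel" "\<And>i \<omega>. \<omega> \<in> space env_borel \<Longrightarrow> 0 \<le> g i \<omega> \<and> g i \<omega> \<le> c"
        "\<And>\<omega>. \<omega> \<in> space env_borel \<Longrightarrow> (\<lambda>i. g i \<omega>) \<longlonglongrightarrow> 0" for g :: "nat \<Rightarrow> 'd environment \<Rightarrow> real" and c
      using tendsto_divide[OF \<Lambda>_cont[OF that] tendsto_const[of Z]] Z by simp
  qed (use Z in \<open>simp_all add: \<Lambda>_nonneg \<Lambda>_add \<Lambda>_cmult add_divide_distrib Z_def\<close>)
  then obtain \<nu> where \<nu>: "prob_space \<nu>" "sets \<nu> = sets env_borel"
    and int: "\<And>g. g \<in> bounded_nonneg \<Longrightarrow> integral\<^sup>L \<nu> g = \<Lambda> g / Z"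
    unfolding bounded_nonneg_def[symmetric] by blast
  interpret nu: prob_space \<nu> by (rule \<nu>(1))
  note [measurable_cong] = \<nu>(2)
  have space: "space \<nu> = space env_borel" by (rule sets_eq_imp_space_eq[OF \<nu>(2)])
  have em: "emeasure \<nu> A = ennreal (\<Lambda> (indicator A) / Z)" if "A \<in> sets env_borel" for A
    using int[OF ind[OF that]] that by (simp add: nu.emeasure_eq_measure \<nu>(2))
  have "env_invariant \<nu>"
    unfolding env_invariant_def
  proof
    fix A :: "'d environment set" assume A: "A \<in> sets env_borel"
    have op: "env_op (indicator A) \<in> bounded_nonneg" by (rule env_op_bounded_nonneg[OF ind[OF A]])
    have op_bounds: "0 \<le> env_op (indicator A) \<omega>" "env_op (indicator A) \<omega> \<le> 1" if "\<omega> \<in> space env_borel" for \<omega>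
      using env_op_bounds[of "indicator A" 1] that by (auto simp: indicator_def)
    have "(\<integral>\<^sup>+\<omega>. (\<Sum>k\<in>UNIV. ennreal (\<E> (\<omega> 0) k) * indicator A (shift (step k) \<omega>)) \<partial>\<nu>) =
        (\<integral>\<^sup>+\<omega>. ennreal (env_op (indicator A) \<omega>) \<partial>\<nu>)"
    proof (rule nn_integral_cong)
      fix \<omega> assume "\<omega> \<in> space \<nu>"
      then have \<omega>: "\<omega> \<in> space env_borel" by (simp add: space)
      have "(\<Sum>k\<in>UNIV. ennreal (\<E> (\<omega> 0) k) * indicator A (shift (step k) \<omega>)) =
          (\<Sum>k\<in>UNIV. ennreal (\<E> (\<omega> 0) k * indicator A (shift (step k) \<omega>)))"
        using \<omega> by (simp add: ennreal_mult prob_nonneg ennreal_indicator)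
      also have "\<dots> = ennreal (env_op (indicator A) \<omega>)"
        unfolding env_op_def using \<omega> by (intro sum_ennreal) (simp add: prob_nonneg)
      finally show "(\<Sum>k\<in>UNIV. ennreal (\<E> (\<omega> 0) k) * indicator A (shift (step k) \<omega>)) =
          ennreal (env_op (indicator A) \<omega>)" .
    qed
    also have "\<dots> = ennreal (integral\<^sup>L \<nu> (env_op (indicator A)))"
    proof (rule nn_integral_eq_integral)
      show "integrable \<nu> (env_op (indicator A))"
        using op_bounds bounded_nonneg_measurable[OF op]
        by (intro nu.integrable_const_bound[of _ 1]) (auto simp: space)
    qed (use op_bounds in \<open>auto simp: space\<close>)
    also have "\<dots> = emeasure \<nu> A"
      by (simp add: int[OF op] \<Lambda>_op[OF ind[OF A]] em[OF A])
    finally show "(\<integral>\<^sup>+\<omega>. (\<Sum>k\<in>UNIV. ennreal (\<E> (\<omega> 0) k) * indicator A (shift (step k) \<omega>)) \<partial>\<nu>) = emeasure \<nu> A" .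
  qed
  moreover have "absolutely_continuous \<mu> \<nu>"
    unfolding absolutely_continuous_def
  proof
    fix A assume A: "A \<in> null_sets \<mu>"
    then have A_sets: "A \<in> sets env_borel" by (auto simp: null_sets_def sets_\<mu>)
    \<comment> \<open>On a null set the integral against \<open>W\<close> vanishes, so the bound
      reduces to its arbitrary additive term.\<close>
    have "(\<integral>\<omega>. indicator A \<omega> * W \<omega> \<partial>\<mu>) = (\<integral>\<omega>. 0 \<partial>\<mu>)"
    proof (rule integral_cong_AE)
      show "AE \<omega> in \<mu>. indicator A \<omega> * W \<omega> = 0"
        using AE_not_in[OF A] by eventually_elim simp
    qed (use A_sets integrable_W in measurable)
    then have "\<Lambda> (indicator A) \<le> 0 + e" if "0 < e" for e
      using \<Lambda>_le[OF ind[OF A_sets], of 1 e] that by (simp add: indicator_def)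
    then have "\<Lambda> (indicator A) \<le> 0" by (rule field_le_epsilon)
    then have "emeasure \<nu> A = 0" using \<Lambda>_nonneg[OF ind[OF A_sets]] by (simp add: em[OF A_sets])
    then show "A \<in> null_sets \<nu>" using A_sets \<nu>(2) by (simp add: null_sets_def)
  qed
  ultimately show ?thesis using \<nu> by blast
qed

end

section \<open>The moment condition gives integrability of the weight; existence, equivalence and
  ergodicity are combined\<close>

theorem theorem3p1:
  fixes \<mu> :: "'d::finite environment measure"
    and \<E> :: "('d dir \<Rightarrow> real) \<Rightarrow> ('d dir \<Rightarrow> real)"
    and p :: real
  assumes "prob_space \<mu>" and "sets \<mu> = sets env_borel"
    and "stationary_under \<mu> (range shift)" and "ergodic_under \<mu> (range shift)"
    and "\<E> \<in> measurable simplex_borel simplex_borel" and "balanced \<E>"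
    and "p > real CARD('d)"
    and "(\<integral>\<^sup>+ \<omega>. inverse (ennreal (step_gmean \<E> 0 \<omega> powr p)) \<partial>\<mu>) < \<infinity>"
    and "measure \<mu> {\<omega> \<in> space \<mu>. \<forall>x k. \<E> (\<omega> x) k > 0} = 1"
  shows "\<exists>\<nu>. prob_space \<nu> \<and> sets \<nu> = sets env_borel \<and>
           absolutely_continuous \<mu> \<nu> \<and> absolutely_continuous \<nu> \<mu> \<and>
           stationary_under (env_process_law \<E> \<nu>) {time_shift} \<and>
           ergodic_under (env_process_law \<E> \<nu>) {time_shift}"
proof -
  interpret prob_space \<mu> by fact
  interpret environment_function \<E> by unfold_locales fact
  note [measurable_cong] = assms(2)
  have space: "space \<mu> = space env_borel" by (rule sets_eq_imp_space_eq[OF assms(2)])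
  have elliptic: "AE \<omega> in \<mu>. \<forall>x k. 0 < \<E> (\<omega> x) k"
    using AE_prob_1[OF assms(9)] by eventually_elim simp
  define W where "W \<omega> = 1 / (\<Prod>i\<in>UNIV. \<E> (\<omega> 0) (Fwd i))" for \<omega> :: "'d environment"
  have W_meas: "W \<in> borel_measurable \<mu>"
    unfolding W_def[abs_def] by measurable
  have W_le: "AE \<omega> in \<mu>. ennreal (norm (W \<omega>)) \<le> inverse (ennreal (step_gmean \<E> 0 \<omega> powr p))"
    using elliptic AE_space
  proof eventually_elim
    case (elim \<omega>)
    then have \<omega>: "\<omega> \<in> space env_borel" by (simp add: space)
    define P where "P = (\<Prod>i\<in>UNIV. \<E> (\<omega> 0) (Fwd i))"
    have le_1: "\<E> (\<omega> 0) k \<le> 1" for k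
      using member_le_sum[of k UNIV "\<E> (\<omega> 0)"] sum_prob[OF \<omega>, of 0] prob_nonneg[OF \<omega>] by simp
    have P: "0 < P" "P \<le> 1"
      using elim(1) le_1 by (auto simp: P_def less_imp_le intro!: prod_pos prod_le_1)
    \<comment> \<open>Balancedness makes the forward and backward products equal. Hence the p-th
      power of the geometric mean is P^(p/d), which is at most \<open>P\<close> because P \<le> 1
      and p > d.\<close>
    have "(\<Prod>k\<in>UNIV - {Stay}. \<E> (\<omega> 0) k) = P powr 2"
      using P assms(6) \<omega> by (simp add: prod_dir P_def balanced_def power2_eq_square)
    then have "step_gmean \<E> 0 \<omega> powr p = P powr (p / CARD('d))"
      by (simp add: step_gmean_def powr_powr)
    also have "\<dots> \<le> P powr 1"
      using P assms(7) by (intro powr_mono') (auto simp: le_divide_eq)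
    finally have le: "step_gmean \<E> 0 \<omega> powr p \<le> P" using P by simp
    \<comment> \<open>At positive arguments the inverse on \<open>ennreal\<close> is the real
      inverse, whereas at 0 it is infinite.\<close>
    have pos: "0 < step_gmean \<E> 0 \<omega> powr p"
      using \<open>step_gmean \<E> 0 \<omega> powr p = P powr (p / CARD('d))\<close> P by simp
    have "norm (W \<omega>) = inverse P" using P by (simp add: W_def P_def[symmetric] inverse_eq_divide)
    also have "\<dots> \<le> inverse (step_gmean \<E> 0 \<omega> powr p)" using le pos by (rule le_imp_inverse_le)
    finally show ?case using pos by (simp add: inverse_ennreal)
  qed
  have "(\<integral>\<^sup>+\<omega>. ennreal (norm (W \<omega>)) \<partial>\<mu>) < \<infinity>"
    using nn_integral_mono_AE[OF W_le] assms(8) by (rule le_less_trans)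
  with W_meas have "integrable \<mu> W" by (simp add: integrable_iff_bounded)
  then interpret balanced_environment \<E> \<mu> W
    using assms elliptic by unfold_locales (auto simp: W_def[abs_def] balanced_def)
  obtain \<nu> where \<nu>: "prob_space \<nu>" "sets \<nu> = sets env_borel" and inv: "env_invariant \<nu>"
    and ac: "absolutely_continuous \<mu> \<nu>"
    using ex_invariant_measure by blast
  have pos: "AE \<omega> in \<mu>. \<forall>k. 0 < \<E> (\<omega> 0) k"
    using elliptic by eventually_elim blast
  show ?thesis
    using \<nu> ac env_invariant_dominates[OF assms(1-4) pos \<nu> inv ac] stationary_env_process_law[OF \<nu> inv]
      ergodic_env_process_law[OF assms(1-4) pos \<nu> inv ac] by blast
qed

end
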